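(* Let $(H_i)_{i\in\mathbb N}$ be a sequence of uniform chains of finite rank. Then the infinite uniform chain product $\prod_{i\in\mathbb N}H_i$ is uniform, and its tail satisfies $$\mathrm f\prod_{i\in\mathbb N}H_i\;\cong\;\sum_{i\in\mathbb N}\Bigl(\prod_{k<i}H_k\Bigr)\,\mathrm f H_i .$$
   Context: A chain is a linearly ordered set; $\cong$ is order isomorphism. $A+B$ and $\sum_{i\in I}A_i$ are ordered sums, $AB=\sum_{b\in B}A$ is the anti-lexicographically ordered product (later factors more significant), iterated to finite products $\prod_{k<i}H_k=H_0H_1\cdots H_{i-1}$; the empty product is the one-element chain $1$. $\mathbb N,\mathbb Z$ have their usual orders, $\mathbb N^*$ is $\mathbb N$ with reversed order, $0$ is the empty chain. For a chain $A$ define convex equivalence relations $\rho_n$: $\rho_0$ is equality; $A/n$ is the quotient chain of $\rho_n$-classes $[x]_n$; $x\rho_{n+1}y$ iff the interval between $[x]_n$ and $[y]_n$ in $A/n$ is finite. $A$ has finite rank $n$ if $n$ is least with $A/n\cong1$. $A$ is uniform if $A^{\ge x}=\{y\in A:x\le y\}$ has the same order type for all $x\in A$; then $\mathrm f A$ denotes this common tail. For $x\in A$ put $\mathrm j_xA=\{y\in A:y<x\}$. Every uniform chain $H$ of finite rank $r$ contains an element $x$ (a "canonical zero") such that $\mathrm j_xH\cong B_{r-1}\mathbb N^*+\dots+B_1\mathbb N^*+B_0\mathbb N^*$, where each $B_i$ is either a uniform chain of rank $i$ or the empty chain; the order type of $\mathrm j_xH$ does not depend on the choice of such an $x$. For uniform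 chains $H_i$ ($i\in\mathbb N$) of finite rank, put $P_i=\prod_{k<i}H_k$, choose canonical zeros $x_i\in H_i$ and put $K_i=\mathrm j_{x_i}H_i$. The infinite uniform chain product is defined as $$\prod_{i\in\mathbb N}H_i=\bigl(\cdots+P_2K_2+P_1K_1+P_0K_0\bigr)+\bigl(P_0\,\mathrm f H_0+P_1\,\mathrm f H_1+P_2\,\mathrm f H_2+\cdots\bigr).$$ *)

theory Defs
  imports Main
begin

text \<open>
  A chain is a reflexive linear order \<^term>\<open>A :: 'a rel\<close> with \<^prop>\<open>Linear_order A\<close>; its set of
  elements is \<^term>\<open>Field A\<close>. The empty chain is \<^term>\<open>{} :: 'a rel\<close>, the natural numbers are
  \<^const>\<open>natLeq\<close>, and reversal is \<^const>\<open>converse\<close>.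
\<close>

text \<open>
  \<^const>\<open>iso\<close> is phrased with initial segments, but by \<open>iso_iff2\<close> it means order isomorphism
  for arbitrary relations, not only for well-orders.
\<close>

definition chain_iso :: "'a rel \<Rightarrow> 'b rel \<Rightarrow> bool" (infix "\<cong>" 50) where
  "A \<cong> B \<longleftrightarrow> (\<exists>f. iso A B f)"

definition chain_one :: "unit rel" where
  "chain_one = {((), ())}"

definition chain_sum :: "'i rel \<Rightarrow> ('i \<Rightarrow> 'a rel) \<Rightarrow> ('i \<times> 'a) rel" where
  "chain_sum I A =
    {((i, x), (j, y)). i \<in> Field I \<and> j \<in> Field I \<and> x \<in> Field (A i) \<and> y \<in> Field (A j) \<and>
       (i \<noteq> j \<and> (i, j) \<in> I \<or> i = j \<and> (x, y) \<in> A i)}"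

definition chain_plus :: "'a rel \<Rightarrow> 'b rel \<Rightarrow> ('a + 'b) rel" where
  "chain_plus A B =
     {(Inl x, Inl y) | x y. (x, y) \<in> A} \<union>
     {(Inl x, Inr y) | x y. x \<in> Field A \<and> y \<in> Field B} \<union>
     {(Inr x, Inr y) | x y. (x, y) \<in> B}"

text \<open>The product \<open>A B\<close>; an element is a pair whose \<^emph>\<open>first\<close> component lies in the later, more
  significant factor \<open>B\<close>.\<close>

definition chain_times :: "'a rel \<Rightarrow> 'b rel \<Rightarrow> ('b \<times> 'a) rel" where
  "chain_times A B = chain_sum B (\<lambda>_. A)"

text \<open>\<open>H 0 \<cdots> H (i - 1)\<close>, iterating the binary product. So that all finite products
  live on one type, the pair \<open>(x, l)\<close> is encoded as the list \<open>x # l\<close>.\<close>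

primrec finite_prod :: "(nat \<Rightarrow> 'a rel) \<Rightarrow> nat \<Rightarrow> 'a list rel" where
  "finite_prod H 0 = {([], [])}"
| "finite_prod H (Suc i) =
     dir_image (chain_times (finite_prod H i) (H i)) (\<lambda>(x, l). x # l)"

text \<open>The quotient of a chain by a convex equivalence relation.\<close>

definition chain_quot :: "'a rel \<Rightarrow> 'a rel \<Rightarrow> 'a set rel" where
  "chain_quot A E = {(E `` {x}, E `` {y}) | x y. (x, y) \<in> A}"

definition interval_between :: "'a rel \<Rightarrow> 'a \<Rightarrow> 'a \<Rightarrow> 'a set" where
  "interval_between A x y =
     {z. (x, z) \<in> A \<and> (z, y) \<in> A \<or> (y, z) \<in> A \<and> (z, x) \<in> A}"

primrec rho :: "'a rel \<Rightarrow> nat \<Rightarrow> 'a rel" where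
  "rho A 0 = Id_on (Field A)"
| "rho A (Suc n) =
     {(x, y). x \<in> Field A \<and> y \<in> Field A \<and>
        finite (interval_between (chain_quot A (rho A n)) (rho A n `` {x}) (rho A n `` {y}))}"

definition has_rank :: "'a rel \<Rightarrow> nat \<Rightarrow> bool" where
  "has_rank A n \<longleftrightarrow>
     chain_quot A (rho A n) \<cong> chain_one \<and> (\<forall>m<n. \<not> chain_quot A (rho A m) \<cong> chain_one)"

definition finite_rank :: "'a rel \<Rightarrow> bool" where
  "finite_rank A \<longleftrightarrow> (\<exists>n. has_rank A n)"

definition chain_from :: "'a rel \<Rightarrow> 'a \<Rightarrow> 'a rel" where
  "chain_from A x = Restr A (above A x)"

definition chain_below :: "'a rel \<Rightarrow> 'a \<Rightarrow> 'a rel" where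
  "chain_below A x = Restr A (underS A x)"

definition uniform :: "'a rel \<Rightarrow> bool" where
  "uniform A \<longleftrightarrow> Linear_order A \<and>
     (\<forall>x\<in>Field A. \<forall>y\<in>Field A. chain_from A x \<cong> chain_from A y)"

text \<open>A representative of the tail; for nonempty uniform \<open>A\<close> its order type does not depend on
  the choice.\<close>

definition common_tail :: "'a rel \<Rightarrow> 'a rel" where
  "common_tail A = chain_from A (SOME x. x \<in> Field A)"

text \<open>The chains \<open>B i\<close> may be taken on the element type of \<open>H\<close>: any chain occurring as such a
  \<open>B i\<close> embeds into \<open>H\<close>, hence is isomorphic to a chain on that type.\<close>

definition canonical_zero :: "'a rel \<Rightarrow> 'a \<Rightarrow> bool" where
  "canonical_zero H x \<longleftrightarrow> x \<in> Field H \<and>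
     (\<exists>r (B :: nat \<Rightarrow> 'a rel). has_rank H r \<and>
        (\<forall>i<r. uniform (B i) \<and> has_rank (B i) i \<or> B i = {}) \<and>
        chain_below H x \<cong>
          chain_sum (Restr (natLeq\<inverse>) {..<r}) (\<lambda>i. chain_times (B i) (natLeq\<inverse>)))"

text \<open>The infinite uniform chain product formed with the elements \<open>x i\<close> of \<open>H i\<close>, which are meant
  to be canonical zeros.\<close>

definition infinite_prod ::
  "(nat \<Rightarrow> 'a rel) \<Rightarrow> (nat \<Rightarrow> 'a) \<Rightarrow> (nat \<times> 'a \<times> 'a list + nat \<times> 'a \<times> 'a list) rel" where
  "infinite_prod H x =
     chain_plus
       (chain_sum (natLeq\<inverse>) (\<lambda>i. chain_times (finite_prod H i) (chain_below (H i) (x i))))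
       (chain_sum natLeq (\<lambda>i. chain_times (finite_prod H i) (common_tail (H i))))"

end

theory Submission
  imports Defs
begin

text \<open>
  Write \<open>P i = H 0 \<cdots> H (i - 1)\<close>, \<open>F i\<close> for the tail of \<open>H i\<close>, \<open>K i\<close> for the part of \<open>H i\<close> below
  the chosen point, and \<open>F i = 1 + R i\<close>, where \<open>R i\<close> is the part of \<open>H i\<close> strictly above any of its
  points. Let \<open>S n\<close> be the sum of the blocks \<open>P i F i\<close> over \<open>i \<ge> n\<close>, so that \<open>S 0\<close> is the claimed tail.
  It has to be shown that every tail of the infinite product is isomorphic to \<open>S 0\<close>.

  A uniform chain \<open>H n\<close> of finite rank either is a single point (and \<open>R n = 0\<close>), or some point, hence
  by uniformity every point, has an immediate successor (and \<open>R n \<cong> F n\<close>); this is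
  \<open>uniform_finite_rank_cases\<close>. Otherwise \<open>H n\<close> would have no finite interval with distinct endpoints,
  all the relations \<open>\<rho>\<^sub>n\<close> would be equality and no quotient of \<open>H n\<close> would be a point.

  The heart of the proof is the absorption law \<open>P n + S n \<cong> S n\<close> (lemma \<open>absorb\<close>). If \<open>R n \<cong> F n\<close>, then
  \<open>P n + P n F n = P n (1 + F n) \<cong> P n F n\<close>. If \<open>H n\<close> is a point, then \<open>P n \<cong> P (n + 1)\<close> and the law for \<open>n\<close>
  follows from the law for \<open>n + 1\<close>; if all \<open>H m\<close> with \<open>m \<ge> n\<close> are points, then \<open>S n\<close> is \<open>\<nat>\<close> copies of \<open>P n\<close>.
  It follows in the same two cases that \<open>P n R n + S (n + 1) \<cong> S n\<close> (\<open>R_block_absorb\<close>).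

  As the tail of \<open>P (n + 1) \<cong> P n H n\<close> is the tail of \<open>P n\<close> followed by \<open>P n R n\<close>, induction on \<open>n\<close> shows that
  the tail of \<open>P n\<close> followed by \<open>S n\<close> is isomorphic to \<open>S 0\<close> (\<open>common_tail_P_S\<close>). This settles the points of
  the right half of the product. For the left half, let \<open>N n = P (n - 1) K (n - 1) + \<cdots> + P 0 K 0\<close>. Then
  \<open>N n + S 0 \<cong> S n\<close> by induction (\<open>N_S\<close>), since \<open>K n + F n \<cong> H n\<close> and \<open>P (n + 1)\<close> is absorbed by \<open>S (n + 1)\<close>.
  The part of \<open>K n\<close> above a point, followed by \<open>F n\<close>, is \<open>R n\<close>, which reduces this case to the previous one.
\<close>

section \<open>Order isomorphisms and linear orders\<close>

notation chain_plus (infixr "\<oplus>" 65)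
notation chain_times (infixl "\<otimes>" 70)

lemma Field_map: "(\<And>x y. (x, y) \<in> A \<Longrightarrow> (f x, f y) \<in> B) \<Longrightarrow> x \<in> Field A \<Longrightarrow> f x \<in> Field B"
  unfolding Field_iff by blast

text \<open>
  Isomorphisms are mostly handled as pairs of mutually inverse monotone maps; this spares the
  treatment of bijectivity.
\<close>

lemma chain_isoI:
  assumes "\<And>x y. (x, y) \<in> A \<Longrightarrow> (f x, f y) \<in> B"
    and "\<And>x y. (x, y) \<in> B \<Longrightarrow> (g x, g y) \<in> A"
    and "\<And>x. x \<in> Field A \<Longrightarrow> g (f x) = x"
    and "\<And>y. y \<in> Field B \<Longrightarrow> f (g y) = y"
  shows "A \<cong> B"
proof -
  have F: "f x \<in> Field B" if "x \<in> Field A" for x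
    using that assms(1) unfolding Field_def by blast
  have G: "g y \<in> Field A" if "y \<in> Field B" for y
    using that assms(2) unfolding Field_def by blast
  have "bij_betw f (Field A) (Field B)"
    by (rule bij_betw_byWitness[where f' = g]) (use assms(3,4) F G in auto)
  moreover have "(x, y) \<in> A \<longleftrightarrow> (f x, f y) \<in> B" if "x \<in> Field A" "y \<in> Field A" for x y
    using assms(1)[of x y] assms(2)[of "f x" "f y"] assms(3)[OF that(1)] assms(3)[OF that(2)]
    by auto
  ultimately show ?thesis unfolding chain_iso_def iso_iff2 by blast
qed

lemma chain_isoE:
  assumes "A \<cong> B"
  obtains f g where "\<And>x y. (x, y) \<in> A \<Longrightarrow> (f x, f y) \<in> B"
    and "\<And>x y. (x, y) \<in> B \<Longrightarrow> (g x, g y) \<in> A"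
    and "\<And>x. x \<in> Field A \<Longrightarrow> g (f x) = x"
    and "\<And>y. y \<in> Field B \<Longrightarrow> f (g y) = y"
    and "iso A B f"
proof -
  from assms obtain f where f: "iso A B f" unfolding chain_iso_def by blast
  then have b: "bij_betw f (Field A) (Field B)"
    and m: "\<And>x y. x \<in> Field A \<Longrightarrow> y \<in> Field A \<Longrightarrow> (x, y) \<in> A \<longleftrightarrow> (f x, f y) \<in> B"
    unfolding iso_iff2 by auto
  let ?g = "inv_into (Field A) f"
  have gf: "?g (f x) = x" if "x \<in> Field A" for x
    using b that by (simp add: bij_betw_inv_into_left)
  have fg: "f (?g y) = y" "?g y \<in> Field A" if "y \<in> Field B" for y
    using b that by (simp_all add: bij_betw_inv_into_right bij_betw_def inv_into_into)
  show ?thesis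
  proof (rule that[of f ?g])
    show "(f x, f y) \<in> B" if "(x, y) \<in> A" for x y
      using that m by (meson FieldI1 FieldI2)
    show "(?g x, ?g y) \<in> A" if "(x, y) \<in> B" for x y
      using that m[of "?g x" "?g y"] fg FieldI1[OF that] FieldI2[OF that] by simp
  qed (use gf fg f in auto)
qed

lemma chain_iso_refl: "A \<cong> A"
  by (rule chain_isoI[where f = id and g = id]) auto

lemma chain_iso_sym: "A \<cong> B \<Longrightarrow> B \<cong> A"
  by (elim chain_isoE, rule chain_isoI) assumption+

lemma chain_iso_trans [trans]:
  assumes "A \<cong> B" "B \<cong> C" shows "A \<cong> C"
proof -
  from assms(1) obtain f g where 1: "\<And>x y. (x, y) \<in> A \<Longrightarrow> (f x, f y) \<in> B"
    "\<And>x y. (x, y) \<in> B \<Longrightarrow> (g x, g y) \<in> A" "\<And>x. x \<in> Field A \<Longrightarrow> g (f x) = x"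
    "\<And>y. y \<in> Field B \<Longrightarrow> f (g y) = y" by (elim chain_isoE) blast
  from assms(2) obtain h k where 2: "\<And>x y. (x, y) \<in> B \<Longrightarrow> (h x, h y) \<in> C"
    "\<And>x y. (x, y) \<in> C \<Longrightarrow> (k x, k y) \<in> B" "\<And>x. x \<in> Field B \<Longrightarrow> k (h x) = x"
    "\<And>y. y \<in> Field C \<Longrightarrow> h (k y) = y" by (elim chain_isoE) blast
  have "f x \<in> Field B" if "x \<in> Field A" for x
    using that 1(1) unfolding Field_def by blast
  moreover have "k y \<in> Field B" if "y \<in> Field C" for y
    using that 2(2) unfolding Field_def by blast
  ultimately show ?thesis
    by (intro chain_isoI[where f = "h \<circ> f" and g = "g \<circ> k"]) (auto simp: 1 2)
qed

lemma chain_iso_inj_image: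
  assumes "inj_on f (Field A)"
  shows "A \<cong> dir_image A f"
proof -
  have g: "inv_into (Field A) f (f x) = x" if "x \<in> Field A" for x
    using assms that by simp
  show ?thesis
    by (rule chain_isoI[where f = f and g = "inv_into (Field A) f"])
      (auto simp: dir_image_Field g, auto simp: dir_image_def g FieldI1 FieldI2)
qed

lemma linear_refl: "Linear_order A \<Longrightarrow> x \<in> Field A \<Longrightarrow> (x, x) \<in> A"
  by (simp add: order_on_defs refl_on_def)

lemma linear_trans: "Linear_order A \<Longrightarrow> (x, y) \<in> A \<Longrightarrow> (y, z) \<in> A \<Longrightarrow> (x, z) \<in> A"
  by (auto simp: order_on_defs dest: transD)

lemma linear_antisym: "Linear_order A \<Longrightarrow> (x, y) \<in> A \<Longrightarrow> (y, x) \<in> A \<Longrightarrow> x = y"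
  by (auto simp: order_on_defs dest: antisymD)

lemma linear_total:
  "Linear_order A \<Longrightarrow> x \<in> Field A \<Longrightarrow> y \<in> Field A \<Longrightarrow> (x, y) \<in> A \<or> (y, x) \<in> A"
  using linear_refl[of A x] unfolding order_on_defs total_on_def by metis

lemma Linear_orderI:
  assumes "\<And>x. x \<in> Field A \<Longrightarrow> (x, x) \<in> A"
    and "\<And>x y z. (x, y) \<in> A \<Longrightarrow> (y, z) \<in> A \<Longrightarrow> (x, z) \<in> A"
    and "\<And>x y. (x, y) \<in> A \<Longrightarrow> (y, x) \<in> A \<Longrightarrow> x = y"
    and "\<And>x y. x \<in> Field A \<Longrightarrow> y \<in> Field A \<Longrightarrow> (x, y) \<in> A \<or> (y, x) \<in> A"
  shows "Linear_order A"
proof -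
  have "A \<subseteq> Field A \<times> Field A" by (auto simp: FieldI1 FieldI2)
  moreover have "refl_on (Field A) A" using assms(1) by (simp add: refl_on_def)
  moreover have "trans A" using assms(2) by (rule transI)
  moreover have "antisym A" using assms(3) by (rule antisymI)
  moreover have "total_on (Field A) A" using assms(4) by (auto simp: total_on_def)
  ultimately show ?thesis by (simp add: order_on_defs)
qed

lemma Linear_order_iso:
  assumes "A \<cong> B" "Linear_order A"
  shows "Linear_order B"
proof -
  from assms(1) obtain f g where 1: "\<And>x y. (x, y) \<in> A \<Longrightarrow> (f x, f y) \<in> B"
    "\<And>x y. (x, y) \<in> B \<Longrightarrow> (g x, g y) \<in> A" "\<And>x. x \<in> Field A \<Longrightarrow> g (f x) = x"
    "\<And>y. y \<in> Field B \<Longrightarrow> f (g y) = y" by (elim chain_isoE) blast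
  have g: "g y \<in> Field A" if "y \<in> Field B" for y
    using that 1(2) unfolding Field_def by blast
  have pull: "(x, y) \<in> B" if "(g x, g y) \<in> A" "x \<in> Field B" "y \<in> Field B" for x y
    using 1(1)[OF that(1)] 1(4) that(2,3) by simp
  show ?thesis
  proof (rule Linear_orderI)
    show "(x, x) \<in> B" if "x \<in> Field B" for x
      using that pull linear_refl[OF assms(2)] g by blast
    show "(x, z) \<in> B" if "(x, y) \<in> B" "(y, z) \<in> B" for x y z
      using that pull[of x z] linear_trans[OF assms(2)] 1(2) by (meson FieldI1 FieldI2)
    show "x = y" if "(x, y) \<in> B" "(y, x) \<in> B" for x y
      using that linear_antisym[OF assms(2)] 1(2) 1(4) by (metis FieldI1 FieldI2)
    show "(x, y) \<in> B \<or> (y, x) \<in> B" if "x \<in> Field B" "y \<in> Field B" for x y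
      using that pull linear_total[OF assms(2)] g by blast
  qed
qed

lemma Field_Restr_linear: "Linear_order A \<Longrightarrow> Field (Restr A U) = Field A \<inter> U"
  using linear_refl[of A] unfolding Field_iff set_eq_iff Int_iff by blast

section \<open>Tails and sums\<close>

text \<open>
  The part of a chain strictly above a point \<open>x\<close>: the tail of \<open>A\<close> at \<open>x\<close> is one point followed by
  \<open>chain_after A x\<close>. If \<open>x\<close> is the least element of an index chain, then this is the chain of the
  remaining indices.
\<close>

definition chain_after :: "'a rel \<Rightarrow> 'a \<Rightarrow> 'a rel" where
  "chain_after A x = Restr A (aboveS A x)"

lemma Field_chain_from: "Linear_order A \<Longrightarrow> Field (chain_from A x) = {y. (x, y) \<in> A}"
  by (auto simp: chain_from_def Field_Restr_linear above_def FieldI2)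

lemma Field_chain_after: "Linear_order A \<Longrightarrow> Field (chain_after A x) = {y. (x, y) \<in> A \<and> y \<noteq> x}"
  by (auto simp: chain_after_def Field_Restr_linear aboveS_def FieldI2)

lemma Field_chain_below: "Linear_order A \<Longrightarrow> Field (chain_below A x) = {y. (y, x) \<in> A \<and> y \<noteq> x}"
  by (auto simp: chain_below_def Field_Restr_linear underS_def FieldI1)

lemmas Linear_order_parts =
  Linear_order_Restr[of A "above A x" for A x, folded chain_from_def]
  Linear_order_Restr[of A "aboveS A x" for A x, folded chain_after_def]
  Linear_order_Restr[of A "underS A x" for A x, folded chain_below_def]

lemma iso_Restr:
  assumes "iso A B f" "Linear_order A" "U \<subseteq> Field A" "V = f ` U"
  shows "Restr A U \<cong> Restr B V"
proof -
  have m: "\<And>x y. x \<in> Field A \<Longrightarrow> y \<in> Field A \<Longrightarrow> (x, y) \<in> A \<longleftrightarrow> (f x, f y) \<in> B"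
    and i: "inj_on f (Field A)"
    using assms(1) unfolding iso_iff2 bij_betw_def by auto
  have "Restr A U \<cong> dir_image (Restr A U) f"
    by (rule chain_iso_inj_image)
      (use i assms in \<open>auto simp: Field_Restr_linear intro: inj_on_subset\<close>)
  also have "dir_image (Restr A U) f = Restr B V"
  proof (intro equalityI subrelI)
    show "(x, y) \<in> Restr B V" if "(x, y) \<in> dir_image (Restr A U) f" for x y
      using that m assms(3,4) unfolding dir_image_def by auto
    show "(x, y) \<in> dir_image (Restr A U) f" if xy: "(x, y) \<in> Restr B V" for x y
    proof -
      obtain a b where "x = f a" "y = f b" "a \<in> U" "b \<in> U" using xy assms(4) by blast
      with xy m[of a b] assms(3) show ?thesis unfolding dir_image_def by blast
    qed
  qed
  finally show ?thesis .
qed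

lemma iso_chain_from:
  assumes "iso A B f" "Linear_order A" "x \<in> Field A"
  shows "chain_from A x \<cong> chain_from B (f x)"
  unfolding chain_from_def
proof (rule iso_Restr[OF assms(1,2)])
  show "above A x \<subseteq> Field A" by (auto simp: above_def FieldI2)
  have m: "\<And>y. y \<in> Field A \<Longrightarrow> (x, y) \<in> A \<longleftrightarrow> (f x, f y) \<in> B"
    and s: "f ` Field A = Field B"
    using assms(1,3) unfolding iso_iff2 bij_betw_def by auto
  show "above B (f x) = f ` above A x"
  proof (intro equalityI subsetI)
    fix y assume y: "y \<in> above B (f x)"
    then have "y \<in> Field B" by (auto simp: above_def FieldI2)
    then obtain z where "z \<in> Field A" "y = f z" using s by blast
    with y m show "y \<in> f ` above A x" by (auto simp: above_def)
  next
    fix y assume "y \<in> f ` above A x"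
    then obtain z where "y = f z" "(x, z) \<in> A" by (auto simp: above_def)
    then show "y \<in> above B (f x)" using m[of z] by (auto simp: above_def FieldI2)
  qed
qed

lemma iso_chain_after:
  assumes "iso A B f" "Linear_order A" "x \<in> Field A"
  shows "chain_after A x \<cong> chain_after B (f x)"
  unfolding chain_after_def
proof (rule iso_Restr[OF assms(1,2)])
  show "aboveS A x \<subseteq> Field A" by (auto simp: aboveS_def FieldI2)
  have m: "\<And>y. y \<in> Field A \<Longrightarrow> (x, y) \<in> A \<longleftrightarrow> (f x, f y) \<in> B"
    and i: "inj_on f (Field A)" and s: "f ` Field A = Field B"
    using assms(1,3) unfolding iso_iff2 bij_betw_def by auto
  show "aboveS B (f x) = f ` aboveS A x"
  proof (intro equalityI subsetI)
    fix y assume y: "y \<in> aboveS B (f x)"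
    then have "y \<in> Field B" by (auto simp: aboveS_def FieldI2)
    then obtain z where "z \<in> Field A" "y = f z" using s by blast
    with y m show "y \<in> f ` aboveS A x" by (auto simp: aboveS_def)
  next
    fix y assume "y \<in> f ` aboveS A x"
    then obtain z where z: "y = f z" "(x, z) \<in> A" "z \<noteq> x" by (auto simp: aboveS_def)
    then show "y \<in> aboveS B (f x)"
      using m[of z] inj_onD[OF i, of z x] assms(3) by (auto simp: aboveS_def FieldI2)
  qed
qed

lemma chain_plus_iff [simp]:
  "(Inl a, Inl b) \<in> A \<oplus> B \<longleftrightarrow> (a, b) \<in> A"
  "(Inl a, Inr c) \<in> A \<oplus> B \<longleftrightarrow> a \<in> Field A \<and> c \<in> Field B"
  "(Inr c, Inl a) \<notin> A \<oplus> B"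
  "(Inr c, Inr d) \<in> A \<oplus> B \<longleftrightarrow> (c, d) \<in> B"
  by (auto simp: chain_plus_def)

lemma chain_plusE:
  assumes "(u, v) \<in> A \<oplus> B"
  obtains a b where "u = Inl a" "v = Inl b" "(a, b) \<in> A"
  | a c where "u = Inl a" "v = Inr c" "a \<in> Field A" "c \<in> Field B"
  | c d where "u = Inr c" "v = Inr d" "(c, d) \<in> B"
  using assms unfolding chain_plus_def by blast

lemma chain_sum_iff:
  "((i, a), (j, b)) \<in> chain_sum I A \<longleftrightarrow> i \<in> Field I \<and> j \<in> Field I \<and> a \<in> Field (A i) \<and> b \<in> Field (A j) \<and>
     (i \<noteq> j \<and> (i, j) \<in> I \<or> i = j \<and> (a, b) \<in> A i)"
  by (simp add: chain_sum_def)

lemma chain_from_iff: "(u, v) \<in> chain_from A x \<longleftrightarrow> (u, v) \<in> A \<and> (x, u) \<in> A \<and> (x, v) \<in> A"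
  by (auto simp: chain_from_def above_def)

lemma chain_after_iff:
  "(u, v) \<in> chain_after A x \<longleftrightarrow> (u, v) \<in> A \<and> (x, u) \<in> A \<and> (x, v) \<in> A \<and> u \<noteq> x \<and> v \<noteq> x"
  by (auto simp: chain_after_def aboveS_def)

lemma Field_chain_plus: "Field (A \<oplus> B) = Field A <+> Field B"
proof (intro equalityI subsetI)
  fix u assume "u \<in> Field (A \<oplus> B)"
  then obtain v where "(u, v) \<in> A \<oplus> B \<or> (v, u) \<in> A \<oplus> B" unfolding Field_def by blast
  then show "u \<in> Field A <+> Field B" by (auto elim!: chain_plusE simp: FieldI1 FieldI2)
next
  fix u assume "u \<in> Field A <+> Field B"
  then show "u \<in> Field (A \<oplus> B)"
  proof
    fix a assume "a \<in> Field A" "u = Inl a"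
    then show ?thesis by (metis Field_iff chain_plus_iff(1))
  next
    fix b assume "b \<in> Field B" "u = Inr b"
    then show ?thesis by (metis Field_iff chain_plus_iff(4))
  qed
qed

lemma Linear_order_plus:
  assumes "Linear_order A" "Linear_order B"
  shows "Linear_order (A \<oplus> B)"
proof (rule Linear_orderI)
  show "(x, x) \<in> A \<oplus> B" if "x \<in> Field (A \<oplus> B)" for x
    using that by (auto simp: Field_chain_plus linear_refl assms)
  show "(x, z) \<in> A \<oplus> B" if "(x, y) \<in> A \<oplus> B" "(y, z) \<in> A \<oplus> B" for x y z
    using that
    by (elim chain_plusE) (auto simp: FieldI1 FieldI2 intro: linear_trans[OF assms(1)] linear_trans[OF assms(2)])
  show "x = y" if "(x, y) \<in> A \<oplus> B" "(y, x) \<in> A \<oplus> B" for x y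
    using that by (elim chain_plusE) (auto intro: linear_antisym[OF assms(1)] linear_antisym[OF assms(2)])
  show "(x, y) \<in> A \<oplus> B \<or> (y, x) \<in> A \<oplus> B" if "x \<in> Field (A \<oplus> B)" "y \<in> Field (A \<oplus> B)" for x y
    using that linear_total[OF assms(1)] linear_total[OF assms(2)]
    unfolding Field_chain_plus by (elim PlusE) simp_all
qed

lemma chain_plus_cong:
  assumes "A \<cong> A'" "B \<cong> B'"
  shows "A \<oplus> B \<cong> A' \<oplus> B'"
proof -
  from assms(1) obtain f g where 1: "\<And>x y. (x, y) \<in> A \<Longrightarrow> (f x, f y) \<in> A'"
    "\<And>x y. (x, y) \<in> A' \<Longrightarrow> (g x, g y) \<in> A" "\<And>x. x \<in> Field A \<Longrightarrow> g (f x) = x"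
    "\<And>y. y \<in> Field A' \<Longrightarrow> f (g y) = y" by (elim chain_isoE) blast
  from assms(2) obtain h k where 2: "\<And>x y. (x, y) \<in> B \<Longrightarrow> (h x, h y) \<in> B'"
    "\<And>x y. (x, y) \<in> B' \<Longrightarrow> (k x, k y) \<in> B" "\<And>x. x \<in> Field B \<Longrightarrow> k (h x) = x"
    "\<And>y. y \<in> Field B' \<Longrightarrow> h (k y) = y" by (elim chain_isoE) blast
  note F = Field_map[of A f A', OF 1(1)] Field_map[of A' g A, OF 1(2)]
    Field_map[of B h B', OF 2(1)] Field_map[of B' k B, OF 2(2)]
  show ?thesis
  proof (rule chain_isoI[where f = "map_sum f h" and g = "map_sum g k"])
    show "(map_sum f h u, map_sum f h v) \<in> A' \<oplus> B'" if "(u, v) \<in> A \<oplus> B" for u v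
      using that by (elim chain_plusE) (simp_all add: 1(1) 2(1) F)
    show "(map_sum g k u, map_sum g k v) \<in> A \<oplus> B" if "(u, v) \<in> A' \<oplus> B'" for u v
      using that by (elim chain_plusE) (simp_all add: 1(2) 2(2) F)
  qed (auto simp: Field_chain_plus 1(3,4) 2(3,4))
qed

lemma chain_plus_assoc: "(A \<oplus> B) \<oplus> C \<cong> A \<oplus> (B \<oplus> C)"
proof -
  let ?f = "\<lambda>x. case x of Inl (Inl a) \<Rightarrow> Inl a | Inl (Inr b) \<Rightarrow> Inr (Inl b) | Inr c \<Rightarrow> Inr (Inr c)"
  let ?g = "\<lambda>x. case x of Inl a \<Rightarrow> Inl (Inl a) | Inr (Inl b) \<Rightarrow> Inl (Inr b) | Inr (Inr c) \<Rightarrow> Inr c"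
  show ?thesis
  proof (rule chain_isoI[where f = ?f and g = ?g])
    show "(?f u, ?f v) \<in> A \<oplus> (B \<oplus> C)" if "(u, v) \<in> (A \<oplus> B) \<oplus> C" for u v
      using that by (auto split: sum.splits simp: Field_chain_plus)
    show "(?g u, ?g v) \<in> (A \<oplus> B) \<oplus> C" if "(u, v) \<in> A \<oplus> (B \<oplus> C)" for u v
      using that by (auto split: sum.splits simp: Field_chain_plus)
  qed (auto split: sum.splits)
qed

lemma chain_plus_empty: "{} \<oplus> A \<cong> A"
  by (rule chain_isoI[where f = "\<lambda>x. case x of Inr a \<Rightarrow> a" and g = Inr])
    (auto simp: Field_chain_plus elim!: chain_plusE)

lemma chain_plus_empty_right: "A \<oplus> {} \<cong> A"
  by (rule chain_isoI[where f = "\<lambda>x. case x of Inl a \<Rightarrow> a" and g = Inl])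
    (auto simp: Field_chain_plus elim!: chain_plusE)

lemma chain_split:
  assumes "Linear_order A" "\<And>u v. u \<in> U \<Longrightarrow> v \<in> V \<Longrightarrow> (u, v) \<in> A \<and> u \<noteq> v"
    "W = U \<union> V" "U \<subseteq> Field A" "V \<subseteq> Field A"
  shows "Restr A W \<cong> Restr A U \<oplus> Restr A V"
proof -
  have nv: "u \<notin> V" if "u \<in> U" for u using assms(2) that by blast
  have no: "(v, u) \<notin> A" if "u \<in> U" "v \<in> V" for u v
    using assms(2)[OF that] linear_antisym[OF assms(1)] by blast
  have F: "Field (Restr A U) = U" "Field (Restr A V) = V" "Field (Restr A W) = U \<union> V"
    using assms by (auto simp: Field_Restr_linear)
  show ?thesis
    by (rule chain_isoI[where f = "\<lambda>x. if x \<in> U then Inl x else Inr x"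
          and g = "case_sum id id"])
      (use assms(2,3) no nv in \<open>auto simp: Field_chain_plus F elim!: chain_plusE\<close>)
qed

lemma Field_chain_sum:
  assumes "Linear_order I" "\<And>i. i \<in> Field I \<Longrightarrow> Linear_order (A i)"
  shows "Field (chain_sum I A) = (SIGMA i:Field I. Field (A i))"
proof -
  have "((i, x), (i, x)) \<in> chain_sum I A" if "i \<in> Field I" "x \<in> Field (A i)" for i x
    using that linear_refl[OF assms(2)] by (simp add: chain_sum_iff)
  then have "(SIGMA i:Field I. Field (A i)) \<subseteq> Field (chain_sum I A)"
    by (auto intro: FieldI1)
  moreover have "p \<in> (SIGMA i:Field I. Field (A i)) \<and> q \<in> (SIGMA i:Field I. Field (A i))"
    if "(p, q) \<in> chain_sum I A" for p q
    using that by (cases p; cases q) (simp add: chain_sum_iff)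
  then have "Field (chain_sum I A) \<subseteq> (SIGMA i:Field I. Field (A i))"
    unfolding Field_def by blast
  ultimately show ?thesis by blast
qed

lemma Linear_order_sum:
  assumes "Linear_order I" "\<And>i. i \<in> Field I \<Longrightarrow> Linear_order (A i)"
  shows "Linear_order (chain_sum I A)"
proof (rule Linear_orderI)
  have F: "Field (chain_sum I A) = (SIGMA i:Field I. Field (A i))"
    by (rule Field_chain_sum) fact+
  show "(x, x) \<in> chain_sum I A" if "x \<in> Field (chain_sum I A)" for x
    using that unfolding F by (auto simp: chain_sum_iff linear_refl assms)
  show "(x, z) \<in> chain_sum I A" if "(x, y) \<in> chain_sum I A" "(y, z) \<in> chain_sum I A" for x y z
  proof -
    obtain i a j b k c where [simp]: "x = (i, a)" "y = (j, b)" "z = (k, c)"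
      by (metis surj_pair)
    have *: "i \<in> Field I" "j \<in> Field I" "k \<in> Field I" "a \<in> Field (A i)" "c \<in> Field (A k)"
      "i \<noteq> j \<and> (i, j) \<in> I \<or> i = j \<and> (a, b) \<in> A i"
      "j \<noteq> k \<and> (j, k) \<in> I \<or> j = k \<and> (b, c) \<in> A j"
      using that by (auto simp: chain_sum_def)
    have "i \<noteq> k \<and> (i, k) \<in> I \<or> i = k \<and> (a, c) \<in> A i"
      using *(1,6,7) linear_trans[OF assms(1), of i j k] linear_trans[OF assms(2), of i a b c]
        linear_antisym[OF assms(1), of i j] by metis
    with * show ?thesis by (simp add: chain_sum_def)
  qed
  show "x = y" if "(x, y) \<in> chain_sum I A" "(y, x) \<in> chain_sum I A" for x y
    using that linear_antisym[OF assms(1)] linear_antisym[OF assms(2)]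
    by (cases x; cases y) (auto simp: chain_sum_iff)
  show "(x, y) \<in> chain_sum I A \<or> (y, x) \<in> chain_sum I A"
    if "x \<in> Field (chain_sum I A)" "y \<in> Field (chain_sum I A)" for x y
  proof -
    obtain i a j b where [simp]: "x = (i, a)" "y = (j, b)" by (metis surj_pair)
    have "i \<in> Field I" "j \<in> Field I" "a \<in> Field (A i)" "b \<in> Field (A j)"
      using that unfolding F by auto
    then show ?thesis
      using linear_total[OF assms(1), of i j] linear_total[OF assms(2), of i a b]
      by (cases "i = j") (auto simp: chain_sum_iff)
  qed
qed

lemma chain_sum_cong:
  assumes "\<And>i. i \<in> Field I \<Longrightarrow> A i \<cong> B i"
    "Linear_order I" "\<And>i. i \<in> Field I \<Longrightarrow> Linear_order (A i)"
  shows "chain_sum I A \<cong> chain_sum I B"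
proof -
  have "\<forall>i\<in>Field I. \<exists>f g. (\<forall>x y. (x, y) \<in> A i \<longrightarrow> (f x, f y) \<in> B i) \<and>
    (\<forall>x y. (x, y) \<in> B i \<longrightarrow> (g x, g y) \<in> A i) \<and> (\<forall>x\<in>Field (A i). g (f x) = x) \<and>
    (\<forall>y\<in>Field (B i). f (g y) = y)"
  proof
    fix i assume "i \<in> Field I"
    from assms(1)[OF this] obtain f g where "\<And>x y. (x, y) \<in> A i \<Longrightarrow> (f x, f y) \<in> B i"
      "\<And>x y. (x, y) \<in> B i \<Longrightarrow> (g x, g y) \<in> A i" "\<And>x. x \<in> Field (A i) \<Longrightarrow> g (f x) = x"
      "\<And>y. y \<in> Field (B i) \<Longrightarrow> f (g y) = y" by (elim chain_isoE) blast
    then show "\<exists>f g. (\<forall>x y. (x, y) \<in> A i \<longrightarrow> (f x, f y) \<in> B i) \<and>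
      (\<forall>x y. (x, y) \<in> B i \<longrightarrow> (g x, g y) \<in> A i) \<and> (\<forall>x\<in>Field (A i). g (f x) = x) \<and>
      (\<forall>y\<in>Field (B i). f (g y) = y)" by blast
  qed
  from bchoice[OF this] obtain f where "\<forall>i\<in>Field I. \<exists>g. (\<forall>x y. (x, y) \<in> A i \<longrightarrow> (f i x, f i y) \<in> B i) \<and>
    (\<forall>x y. (x, y) \<in> B i \<longrightarrow> (g x, g y) \<in> A i) \<and> (\<forall>x\<in>Field (A i). g (f i x) = x) \<and>
    (\<forall>y\<in>Field (B i). f i (g y) = y)" ..
  from bchoice[OF this] obtain g where *: "\<forall>i\<in>Field I. (\<forall>x y. (x, y) \<in> A i \<longrightarrow> (f i x, f i y) \<in> B i) \<and>
    (\<forall>x y. (x, y) \<in> B i \<longrightarrow> (g i x, g i y) \<in> A i) \<and> (\<forall>x\<in>Field (A i). g i (f i x) = x) \<and>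
    (\<forall>y\<in>Field (B i). f i (g i y) = y)" ..
  have 1: "\<And>i x y. i \<in> Field I \<Longrightarrow> (x, y) \<in> A i \<Longrightarrow> (f i x, f i y) \<in> B i"
    "\<And>i x y. i \<in> Field I \<Longrightarrow> (x, y) \<in> B i \<Longrightarrow> (g i x, g i y) \<in> A i"
    "\<And>i x. i \<in> Field I \<Longrightarrow> x \<in> Field (A i) \<Longrightarrow> g i (f i x) = x"
    "\<And>i y. i \<in> Field I \<Longrightarrow> y \<in> Field (B i) \<Longrightarrow> f i (g i y) = y"
    by (simp_all add: *)
  have F: "f i x \<in> Field (B i)" if "i \<in> Field I" "x \<in> Field (A i)" for i x
    using that by (intro Field_map[of "A i" "f i"] 1(1))
  have G: "g i x \<in> Field (A i)" if "i \<in> Field I" "x \<in> Field (B i)" for i x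
    using that by (intro Field_map[of "B i" "g i"] 1(2))
  have lB: "Linear_order (B i)" if "i \<in> Field I" for i
    using assms(1,3) that Linear_order_iso by blast
  have FA: "Field (chain_sum I A) = (SIGMA i:Field I. Field (A i))"
    by (rule Field_chain_sum) fact+
  have FB: "Field (chain_sum I B) = (SIGMA i:Field I. Field (B i))"
    by (rule Field_chain_sum) fact+
  let ?f = "\<lambda>(i, x). (i, f i x)" and ?g = "\<lambda>(i, x). (i, g i x)"
  show ?thesis
  proof (rule chain_isoI[where f = ?f and g = ?g])
    show "(?f p, ?f q) \<in> chain_sum I B" if "(p, q) \<in> chain_sum I A" for p q
      using that by (cases p; cases q) (auto simp: chain_sum_iff F intro: 1(1))
    show "(?g p, ?g q) \<in> chain_sum I A" if "(p, q) \<in> chain_sum I B" for p q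
      using that by (cases p; cases q) (auto simp: chain_sum_iff G intro: 1(2))
  qed (auto simp: FA FB 1(3,4))
qed

text \<open>
  The tail of a sum at a point of its \<open>i\<close>-th summand. It covers products as well, since these are
  sums with constant summands.
\<close>

lemma chain_sum_tail:
  assumes "Linear_order I" "\<And>j. j \<in> Field I \<Longrightarrow> Linear_order (A j)"
    "i \<in> Field I" "a \<in> Field (A i)"
  shows "chain_from (chain_sum I A) (i, a) \<cong> chain_from (A i) a \<oplus> chain_sum (chain_after I i) A"
proof -
  have lo: "Linear_order (chain_from (A i) a)" "Linear_order (chain_after I i)"
    using assms by (simp_all add: Linear_order_parts)
  have Fs: "Field (chain_sum (chain_after I i) A) = (SIGMA j:Field (chain_after I i). Field (A j))"
    by (rule Field_chain_sum[OF lo(2)]) (use assms in \<open>auto simp: Field_chain_after FieldI2\<close>)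
  have ls: "Linear_order (chain_sum I A)" by (rule Linear_order_sum) fact+
  note F = Field_chain_from[OF assms(2)[OF assms(3)]] Field_chain_after[OF assms(1)]
    Field_chain_from[OF ls] Fs
  have ia: "((i, a), (j, y)) \<in> chain_sum I A \<longleftrightarrow>
      j = i \<and> (a, y) \<in> A i \<or> j \<noteq> i \<and> (i, j) \<in> I \<and> y \<in> Field (A j)" for j y
    using assms(3,4) by (auto simp: chain_sum_def FieldI2)
  let ?f = "\<lambda>(j, y). if j = i then Inl y else Inr (j, y)"
  let ?g = "\<lambda>x. case x of Inl y \<Rightarrow> (i, y) | Inr p \<Rightarrow> p"
  show ?thesis
  proof (rule chain_isoI[where f = ?f and g = ?g])
    fix p q assume *: "(p, q) \<in> chain_from (chain_sum I A) (i, a)"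
    obtain j y k z where [simp]: "p = (j, y)" "q = (k, z)" by fastforce
    have "k \<noteq> i" if "j \<noteq> i"
      using that * linear_antisym[OF assms(1), of i j] by (auto simp: chain_from_iff chain_sum_iff)
    then show "(?f p, ?f q) \<in> chain_from (A i) a \<oplus> chain_sum (chain_after I i) A"
      using * by (auto simp: chain_from_iff ia F) (auto simp: chain_sum_iff chain_after_iff F)
  next
    fix u v assume "(u, v) \<in> chain_from (A i) a \<oplus> chain_sum (chain_after I i) A"
    then show "(?g u, ?g v) \<in> chain_from (chain_sum I A) (i, a)"
      using assms(3) by (cases u; cases v)
       (auto simp: chain_from_iff ia F, auto simp: chain_sum_iff chain_after_iff F FieldI1 FieldI2)
  next
    fix u assume "u \<in> Field (chain_from (A i) a \<oplus> chain_sum (chain_after I i) A)"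
    then show "?f (?g u) = u" by (auto simp: Field_chain_plus F)
  qed auto
qed

lemma Linear_order_times: "Linear_order A \<Longrightarrow> Linear_order B \<Longrightarrow> Linear_order (A \<otimes> B)"
  by (simp add: chain_times_def Linear_order_sum)

lemma Field_chain_times: "Linear_order A \<Longrightarrow> Linear_order B \<Longrightarrow> Field (A \<otimes> B) = Field B \<times> Field A"
  by (simp add: chain_times_def Field_chain_sum)

lemma chain_times_iff:
  "((b, a), (d, c)) \<in> A \<otimes> B \<longleftrightarrow> a \<in> Field A \<and> c \<in> Field A \<and> b \<in> Field B \<and> d \<in> Field B \<and>
     (b \<noteq> d \<and> (b, d) \<in> B \<or> b = d \<and> (a, c) \<in> A)"
  by (auto simp: chain_times_def chain_sum_iff)

lemma Field_chain_one: "Field chain_one = {()}"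
  by (auto simp: chain_one_def Field_def)

lemma Linear_order_chain_one: "Linear_order chain_one"
  by (rule Linear_orderI) (auto simp: chain_one_def Field_def)

lemma chain_from_plus_Inr:
  assumes "Linear_order A" "Linear_order B"
  shows "chain_from (A \<oplus> B) (Inr b) \<cong> chain_from B b"
proof (rule chain_isoI[where f = "\<lambda>u. case u of Inr c \<Rightarrow> c" and g = Inr])
  show "(case u of Inr c \<Rightarrow> c, case v of Inr c \<Rightarrow> c) \<in> chain_from B b"
    if "(u, v) \<in> chain_from (A \<oplus> B) (Inr b)" for u v
    using that by (cases u; cases v) (auto simp: chain_from_iff)
  show "Inr (case u of Inr c \<Rightarrow> c) = u" if "u \<in> Field (chain_from (A \<oplus> B) (Inr b))" for u
    using that by (cases u) (auto simp: Field_chain_from Linear_order_plus assms)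
qed (auto simp: chain_from_iff)

lemma chain_from_plus_Inl:
  assumes "Linear_order A" "a \<in> Field A"
  shows "chain_from (A \<oplus> B) (Inl a) = chain_from A a \<oplus> B"
proof -
  have "(u, v) \<in> chain_from (A \<oplus> B) (Inl a) \<longleftrightarrow> (u, v) \<in> chain_from A a \<oplus> B" for u v
    using assms(2)
    by (cases u; cases v) (auto simp: chain_from_iff Field_chain_from assms(1) FieldI1 FieldI2)
  then show ?thesis by (simp add: set_eq_iff)
qed

lemma chain_after_from:
  assumes "Linear_order A" "(x, y) \<in> A"
  shows "chain_after (chain_from A x) y = chain_after A y"
proof -
  have "(u, v) \<in> chain_after (chain_from A x) y \<longleftrightarrow> (u, v) \<in> chain_after A y" for u v
    using linear_trans[OF assms, of u] linear_trans[OF assms, of v] assms(2)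
      linear_refl[OF assms(1) FieldI1[OF assms(2)]]
    by (auto simp: chain_from_iff chain_after_iff)
  then show ?thesis by (simp add: set_eq_iff)
qed

lemma chain_from_split:
  assumes "Linear_order A" "x \<in> Field A"
  shows "chain_from A x \<cong> chain_one \<oplus> chain_after A x"
proof -
  have x: "(x, x) \<in> A" by (rule linear_refl) fact+
  let ?f = "\<lambda>y. if y = x then Inl () else Inr y" and ?g = "\<lambda>u. case u of Inl _ \<Rightarrow> x | Inr y \<Rightarrow> y"
  show ?thesis
  proof (rule chain_isoI[where f = ?f and g = ?g])
    show "(?f u, ?f v) \<in> chain_one \<oplus> chain_after A x" if "(u, v) \<in> chain_from A x" for u v
      using that linear_antisym[OF assms(1), of x u]
      by (auto simp: chain_from_iff chain_after_iff Field_chain_one Field_chain_after assms(1))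
        (auto simp: chain_one_def)
    show "(?g u, ?g v) \<in> chain_from A x" if "(u, v) \<in> chain_one \<oplus> chain_after A x" for u v
      using that x by (cases u; cases v)
        (auto simp: chain_from_iff chain_after_iff Field_chain_after assms(1))
  qed (auto simp: Field_chain_plus Field_chain_one Field_chain_after assms(1))
qed

lemma chain_times_one:
  assumes "Linear_order A"
  shows "A \<otimes> chain_one \<cong> A"
proof (rule chain_isoI[where f = snd and g = "\<lambda>a. ((), a)"])
  show "(snd p, snd q) \<in> A" if "(p, q) \<in> A \<otimes> chain_one" for p q
    using that by (cases p; cases q) (auto simp: chain_times_iff)
qed (auto simp: chain_times_iff Field_chain_one FieldI1 FieldI2)

lemma chain_times_empty: "A \<otimes> {} = {}"
  by (auto simp: chain_times_def chain_sum_def)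

lemma chain_times_plus:
  assumes "Linear_order A" "Linear_order B" "Linear_order C"
  shows "A \<otimes> (B \<oplus> C) \<cong> A \<otimes> B \<oplus> A \<otimes> C"
proof -
  let ?f = "\<lambda>(u, a). case u of Inl b \<Rightarrow> Inl (b, a) | Inr c \<Rightarrow> Inr (c, a)"
  let ?g = "\<lambda>w. case w of Inl (b, a) \<Rightarrow> (Inl b, a) | Inr (c, a) \<Rightarrow> (Inr c, a)"
  note F = Field_chain_times[OF assms(1,2)] Field_chain_times[OF assms(1,3)]
    Field_chain_times[OF assms(1) Linear_order_plus[OF assms(2,3)]] Field_chain_plus
  show ?thesis
  proof (rule chain_isoI[where f = ?f and g = ?g])
    show "(?f p, ?f q) \<in> A \<otimes> B \<oplus> A \<otimes> C" if "(p, q) \<in> A \<otimes> (B \<oplus> C)" for p q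
    proof -
      obtain u a v d where [simp]: "p = (u, a)" "q = (v, d)" by fastforce
      show ?thesis using that by (cases u; cases v) (auto simp: chain_times_iff F)
    qed
    show "(?g u, ?g v) \<in> A \<otimes> (B \<oplus> C)" if "(u, v) \<in> A \<otimes> B \<oplus> A \<otimes> C" for u v
      using that by (elim chain_plusE) (auto simp: chain_times_iff F split: prod.splits)
  qed (auto simp: F)
qed

lemma chain_times_cong_right:
  assumes "B \<cong> C" "Linear_order A" "Linear_order B"
  shows "A \<otimes> B \<cong> A \<otimes> C"
proof -
  from assms(1) obtain f g where 1: "\<And>x y. (x, y) \<in> B \<Longrightarrow> (f x, f y) \<in> C"
    "\<And>x y. (x, y) \<in> C \<Longrightarrow> (g x, g y) \<in> B" "\<And>x. x \<in> Field B \<Longrightarrow> g (f x) = x"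
    "\<And>y. y \<in> Field C \<Longrightarrow> f (g y) = y" by (elim chain_isoE) blast
  note F = Field_map[of B f C, OF 1(1)] Field_map[of C g B, OF 1(2)]
  have "Linear_order C" using Linear_order_iso assms(1,3) by blast
  note FF = Field_chain_times[OF assms(2,3)] Field_chain_times[OF assms(2) this]
  have f: "f x \<noteq> f y" if "x \<noteq> y" "x \<in> Field B" "y \<in> Field B" for x y
    using that 1(3) by metis
  have g: "g x \<noteq> g y" if "x \<noteq> y" "x \<in> Field C" "y \<in> Field C" for x y
    using that 1(4) by metis
  let ?f = "\<lambda>(b, a). (f b, a)" and ?g = "\<lambda>(c, a). (g c, a)"
  show ?thesis
  proof (rule chain_isoI[where f = ?f and g = ?g])
    show "(?f p, ?f q) \<in> A \<otimes> C" if "(p, q) \<in> A \<otimes> B" for p q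
      using that by (cases p; cases q) (auto simp: chain_times_iff F 1(1) dest: f)
    show "(?g p, ?g q) \<in> A \<otimes> B" if "(p, q) \<in> A \<otimes> C" for p q
      using that by (cases p; cases q) (auto simp: chain_times_iff F 1(2) dest: g)
  qed (auto simp: FF 1(3,4))
qed

lemma chain_sum_first:
  assumes "Linear_order I" "\<And>j. j \<in> Field I \<Longrightarrow> Linear_order (A j)"
    "i \<in> Field I" "\<And>j. j \<in> Field I \<Longrightarrow> (i, j) \<in> I"
  shows "chain_sum I A \<cong> A i \<oplus> chain_sum (chain_after I i) A"
proof -
  have Fs: "Field (chain_sum I A) = (SIGMA j:Field I. Field (A j))"
    by (rule Field_chain_sum) fact+
  have Fa: "Field (chain_sum (chain_after I i) A) = (SIGMA j:Field (chain_after I i). Field (A j))"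
    using assms by (intro Field_chain_sum Linear_order_parts) (auto simp: Field_chain_after FieldI2)
  note F = Field_chain_after[OF assms(1)] Fs Fa
  let ?f = "\<lambda>(j, y). if j = i then Inl y else Inr (j, y)"
  let ?g = "\<lambda>x. case x of Inl y \<Rightarrow> (i, y) | Inr p \<Rightarrow> p"
  show ?thesis
  proof (rule chain_isoI[where f = ?f and g = ?g])
    fix p q assume *: "(p, q) \<in> chain_sum I A"
    obtain j y k z where [simp]: "p = (j, y)" "q = (k, z)" by fastforce
    have "k \<noteq> i" if "j \<noteq> i"
      using that * linear_antisym[OF assms(1), of i j] assms(4)[of j] by (auto simp: chain_sum_iff)
    then show "(?f p, ?f q) \<in> A i \<oplus> chain_sum (chain_after I i) A"
      using * assms(4)[of j] assms(4)[of k] by (auto simp: F chain_sum_iff chain_after_iff)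
  next
    fix u v assume "(u, v) \<in> A i \<oplus> chain_sum (chain_after I i) A"
    then show "(?g u, ?g v) \<in> chain_sum I A"
      using assms(3)
      by (elim chain_plusE) (auto simp: chain_sum_iff chain_after_iff F FieldI1 FieldI2)
  next
    fix u assume "u \<in> Field (A i \<oplus> chain_sum (chain_after I i) A)"
    then show "?f (?g u) = u" by (auto simp: Field_chain_plus F)
  qed auto
qed

lemma chain_times_tail:
  assumes "Linear_order A" "Linear_order B" "b \<in> Field B" "a \<in> Field A"
  shows "chain_from (A \<otimes> B) (b, a) \<cong> chain_from A a \<oplus> A \<otimes> chain_after B b"
  unfolding chain_times_def by (rule chain_sum_tail) (use assms in auto)

lemma chain_below_from:
  assumes "Linear_order A" "x \<in> Field A"
  shows "chain_below A x \<oplus> chain_from A x \<cong> A"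
proof -
  have "Restr A (Field A) \<cong> Restr A (underS A x) \<oplus> Restr A (above A x)"
  proof (rule chain_split[OF assms(1)])
    show "(u, v) \<in> A \<and> u \<noteq> v" if "u \<in> underS A x" "v \<in> above A x" for u v
      using that linear_trans[OF assms(1), of u x v] linear_antisym[OF assms(1), of u x]
      by (auto simp: underS_def above_def)
    show "Field A = underS A x \<union> above A x"
      using linear_total[OF assms] linear_refl[OF assms]
      by (auto simp: underS_def above_def FieldI1 FieldI2)
  qed (auto simp: underS_def above_def FieldI1 FieldI2)
  moreover have "Restr A (Field A) = A" by (auto simp: FieldI1 FieldI2)
  ultimately show ?thesis by (simp add: chain_below_def chain_from_def chain_iso_sym)
qed

lemma chain_after_below_from:
  assumes "Linear_order A" "(k, x) \<in> A" "k \<noteq> x"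
  shows "chain_after (chain_below A x) k \<oplus> chain_from A x \<cong> chain_after A k"
proof -
  have "Restr A (aboveS A k) \<cong> Restr A (underS A x \<inter> aboveS A k) \<oplus> Restr A (above A x)"
  proof (rule chain_split[OF assms(1)])
    show "(u, v) \<in> A \<and> u \<noteq> v" if "u \<in> underS A x \<inter> aboveS A k" "v \<in> above A x" for u v
      using that linear_trans[OF assms(1), of u x v] linear_antisym[OF assms(1), of u x]
      by (auto simp: underS_def above_def)
    have "(k, u) \<in> A \<and> u \<noteq> k" if "(x, u) \<in> A" for u
      using linear_trans[OF assms(1,2) that] linear_antisym[OF assms(1,2)] that assms(3) by auto
    then show "aboveS A k = underS A x \<inter> aboveS A k \<union> above A x"
      using linear_total[OF assms(1) FieldI2[OF assms(2)] FieldI2[of k _ A]]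
        linear_refl[OF assms(1) FieldI2[OF assms(2)]]
      by (auto simp: underS_def above_def aboveS_def)
  qed (auto simp: underS_def above_def FieldI1 FieldI2)
  moreover have "Restr A (underS A x \<inter> aboveS A k) = chain_after (chain_below A x) k"
    using assms by (auto simp: chain_after_def chain_below_def underS_def aboveS_def)
  ultimately show ?thesis by (simp add: chain_after_def chain_from_def chain_iso_sym)
qed

section \<open>Uniform chains\<close>

lemma uniformD:
  "uniform A \<Longrightarrow> Linear_order A"
  "uniform A \<Longrightarrow> x \<in> Field A \<Longrightarrow> y \<in> Field A \<Longrightarrow> chain_from A x \<cong> chain_from A y"
  by (auto simp: uniform_def)

lemma uniformI:
  assumes "Linear_order A" "\<And>x. x \<in> Field A \<Longrightarrow> chain_from A x \<cong> T"
  shows "uniform A"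
  unfolding uniform_def using assms chain_iso_trans[OF assms(2) chain_iso_sym[OF assms(2)]] by blast

lemma chain_from_iso_common_tail:
  assumes "uniform A" "x \<in> Field A"
  shows "chain_from A x \<cong> common_tail A"
  unfolding common_tail_def
  using assms by (intro uniformD(2)) (auto intro: someI)

lemma uniform_iso:
  assumes "A \<cong> B" "uniform A"
  shows "uniform B"
proof (rule uniformI)
  show "Linear_order B" using Linear_order_iso[OF assms(1) uniformD(1)[OF assms(2)]] .
  fix y assume y: "y \<in> Field B"
  from assms(1) obtain f where f: "iso A B f" unfolding chain_iso_def ..
  then obtain x where x: "x \<in> Field A" "y = f x"
    using y unfolding iso_iff2 bij_betw_def by blast
  have "chain_from B y \<cong> chain_from A x"
    unfolding x(2) by (rule chain_iso_sym, rule iso_chain_from) (use f x assms(2) uniformD(1) in auto)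
  also have "\<dots> \<cong> common_tail A" by (rule chain_from_iso_common_tail) fact+
  finally show "chain_from B y \<cong> common_tail A" .
qed

text \<open>
  An isomorphism of tails maps the least element to the least element.
\<close>

lemma uniform_chain_after:
  assumes "uniform A" "x \<in> Field A" "y \<in> Field A"
  shows "chain_after A x \<cong> chain_after A y"
proof -
  note lin = uniformD(1)[OF assms(1)]
  have xx: "(x, x) \<in> A" "(y, y) \<in> A" using linear_refl[OF lin] assms(2,3) by auto
  note F = Field_chain_from[OF lin]
  obtain f g where 1: "\<And>u v. (u, v) \<in> chain_from A x \<Longrightarrow> (f u, f v) \<in> chain_from A y"
    "\<And>u v. (u, v) \<in> chain_from A y \<Longrightarrow> (g u, g v) \<in> chain_from A x"
    "\<And>v. v \<in> Field (chain_from A y) \<Longrightarrow> f (g v) = v"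
    "iso (chain_from A x) (chain_from A y) f"
    by (rule chain_isoE[OF uniformD(2)[OF assms]]) blast
  have "(x, g y) \<in> A" using 1(2)[of y y] xx by (simp add: chain_from_iff)
  then have "(x, g y) \<in> chain_from A x" using xx by (simp add: chain_from_iff)
  from 1(1)[OF this] have "(f x, f (g y)) \<in> A" "(y, f x) \<in> A" by (auto simp: chain_from_iff)
  moreover have "f (g y) = y" using 1(3)[of y] xx by (simp add: F)
  ultimately have fx: "f x = y" using linear_antisym[OF lin] by simp
  have "chain_after (chain_from A x) x \<cong> chain_after (chain_from A y) (f x)"
    by (rule iso_chain_after[OF 1(4) Linear_order_parts(1)[OF lin]]) (simp add: F xx)
  then show ?thesis by (simp add: fx chain_after_from lin xx)
qed

lemma uniform_times:
  assumes "uniform A" "uniform B"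
  shows "uniform (A \<otimes> B)"
proof (cases "Field B = {}")
  case True
  then have "B = {}" by (auto simp: Field_def)
  then show ?thesis using assms by (simp add: chain_times_empty)
    (simp add: uniform_def order_on_defs)
next
  case False
  then obtain b0 where b0: "b0 \<in> Field B" by blast
  note lin = uniformD(1)[OF assms(1)] uniformD(1)[OF assms(2)]
  show ?thesis
  proof (rule uniformI)
    show "Linear_order (A \<otimes> B)" by (rule Linear_order_times) fact+
    fix p assume p: "p \<in> Field (A \<otimes> B)"
    then obtain b a where ba: "p = (b, a)" "b \<in> Field B" "a \<in> Field A"
      by (auto simp: Field_chain_times lin)
    have "chain_from (A \<otimes> B) p \<cong> chain_from A a \<oplus> A \<otimes> chain_after B b"
      unfolding ba(1) by (rule chain_times_tail) fact+
    also have "\<dots> \<cong> common_tail A \<oplus> A \<otimes> chain_after B b0"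
      by (intro chain_plus_cong chain_from_iso_common_tail chain_times_cong_right
        uniform_chain_after Linear_order_parts lin assms ba b0)
    finally show "chain_from (A \<otimes> B) p \<cong> common_tail A \<oplus> A \<otimes> chain_after B b0" .
  qed
qed

lemma chain_iso_oneI:
  assumes "Linear_order A" "Field A = {x}"
  shows "A \<cong> chain_one"
proof (rule chain_isoI[where f = "\<lambda>_. ()" and g = "\<lambda>_. x"])
  show "(x, x) \<in> A" by (rule linear_refl) (use assms in auto)
qed (use assms in \<open>auto simp: chain_one_def\<close>)

section \<open>Uniform chains of finite rank\<close>

text \<open>
  A chain without finite intervals between distinct points is not changed by any of the quotients,
  so that it can have finite rank only if it is a single point.
\<close>

lemma rho_trivial_if_dense:
  assumes lin: "Linear_order A"
    and dense: "\<And>x y. x \<in> Field A \<Longrightarrow> y \<in> Field A \<Longrightarrow> x \<noteq> y \<Longrightarrow> infinite (interval_between A x y)"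
  shows "rho A n = Id_on (Field A)"
proof (induction n)
  case (Suc n)
  have cls: "Id_on (Field A) `` {x} = {x}" if "x \<in> Field A" for x using that by auto
  have Q: "({u}, {v}) \<in> chain_quot A (Id_on (Field A)) \<longleftrightarrow> (u, v) \<in> A" for u v
  proof
    assume "({u}, {v}) \<in> chain_quot A (Id_on (Field A))"
    then obtain x y where "{u} = Id_on (Field A) `` {x}" "{v} = Id_on (Field A) `` {y}" "(x, y) \<in> A"
      unfolding chain_quot_def by blast
    then show "(u, v) \<in> A" by (simp add: cls FieldI1 FieldI2)
  next
    assume "(u, v) \<in> A"
    moreover from this have "{u} = Id_on (Field A) `` {u}" "{v} = Id_on (Field A) `` {v}"
      using cls FieldI1 FieldI2 by metis+
    ultimately show "({u}, {v}) \<in> chain_quot A (Id_on (Field A))"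
      unfolding chain_quot_def by blast
  qed
  have sub: "(\<lambda>z. {z}) ` interval_between A x y \<subseteq> interval_between (chain_quot A (Id_on (Field A))) {x} {y}" for x y
    unfolding interval_between_def using Q by auto
  have "infinite (interval_between (chain_quot A (Id_on (Field A))) {x} {y})"
    if "x \<in> Field A" "y \<in> Field A" "x \<noteq> y" for x y
    using dense[OF that] finite_subset[OF sub[of x y]] finite_imageD[of "\<lambda>z. {z}" "interval_between A x y"]
    by (auto simp: inj_on_def)
  moreover have "finite (interval_between (chain_quot A (Id_on (Field A))) {x} {x})"
    if "x \<in> Field A" for x
  proof (rule finite_subset)
    show "interval_between (chain_quot A (Id_on (Field A))) {x} {x} \<subseteq> {{x}}"
    proof
      fix z assume z: "z \<in> interval_between (chain_quot A (Id_on (Field A))) {x} {x}"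
      then obtain u where u: "z = {u}"
        by (auto simp: interval_between_def chain_quot_def FieldI1 FieldI2 cls)
      then have "(u, x) \<in> A" "(x, u) \<in> A" using z Q by (auto simp: interval_between_def)
      with u show "z \<in> {{x}}" using linear_antisym[OF lin] by auto
    qed
  qed simp
  ultimately have "finite (interval_between (chain_quot A (Id_on (Field A))) {x} {y}) \<longleftrightarrow> x = y"
    if "x \<in> Field A" "y \<in> Field A" for x y using that by (cases "x = y") auto
  then have "(x, y) \<in> rho A (Suc n) \<longleftrightarrow> (x, y) \<in> Id_on (Field A)" for x y
    by (auto simp: Suc cls)
  then show ?case by (simp only: set_eq_iff split_paired_All) blast
qed simp

lemma immediate_successor:
  assumes lin: "Linear_order A" and "(x, y) \<in> A" "x \<noteq> y" "finite {z. (x, z) \<in> A \<and> (z, y) \<in> A}"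
  obtains s where "s \<in> Field A" "chain_after A x = chain_from A s"
proof -
  let ?Z = "{z. (x, z) \<in> A \<and> (z, y) \<in> A} - {x}"
  have "\<exists>s\<in>?Z. \<forall>z\<in>?Z. z \<noteq> s \<longrightarrow> \<not> (z, s) \<in> A - Id"
  proof (rule Finite_Set.bex_min_element)
    show "finite ?Z" using assms(4) by simp
    show "asymp_on ?Z (\<lambda>u v. (u, v) \<in> A - Id)"
    proof (intro asymp_onI)
      fix u v assume "(u, v) \<in> A - Id"
      then show "\<not> (v, u) \<in> A - Id" using linear_antisym[OF lin, of u v] by auto
    qed
    show "transp_on ?Z (\<lambda>u v. (u, v) \<in> A - Id)"
    proof (intro transp_onI)
      fix u v w assume "(u, v) \<in> A - Id" "(v, w) \<in> A - Id"
      then show "(u, w) \<in> A - Id"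
        using linear_trans[OF lin, of u v w] linear_antisym[OF lin, of u v] by auto
    qed
    show "?Z \<noteq> {}" using assms(2,3) linear_refl[OF lin FieldI2[OF assms(2)]] by auto
  qed
  then obtain s where s: "(x, s) \<in> A" "(s, y) \<in> A" "s \<noteq> x"
    and min: "\<And>z. (x, z) \<in> A \<Longrightarrow> (z, y) \<in> A \<Longrightarrow> z \<noteq> x \<Longrightarrow> z \<noteq> s \<Longrightarrow> (z, s) \<notin> A"
    by auto
  have sF: "s \<in> Field A" using FieldI2[OF s(1)] .
  have "(s, z) \<in> A \<longleftrightarrow> (x, z) \<in> A \<and> z \<noteq> x" for z
  proof
    assume "(s, z) \<in> A"
    then show "(x, z) \<in> A \<and> z \<noteq> x"
      using linear_trans[OF lin s(1)] linear_antisym[OF lin s(1)] s(3) by blast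
  next
    assume z: "(x, z) \<in> A \<and> z \<noteq> x"
    show "(s, z) \<in> A"
    proof (rule ccontr)
      assume "(s, z) \<notin> A"
      then have "(z, s) \<in> A" "z \<noteq> s"
        using linear_total[OF lin sF] linear_refl[OF lin sF] FieldI2 z by metis+
      with min[of z] z linear_trans[OF lin _ s(2)] show False by blast
    qed
  qed
  then have "chain_after A x = chain_from A s"
    by (auto simp: set_eq_iff chain_after_iff chain_from_iff)
  with sF show ?thesis by (rule that)
qed

text \<open>
  The only consequence of finite rank that the theorem needs: a uniform chain of finite rank is a
  single point, or its tail is isomorphic to the tail without its least element.
\<close>

lemma uniform_finite_rank_cases:
  assumes "uniform A" "finite_rank A" "h \<in> Field A"
  obtains "Field A = {h}" | "chain_after A h \<cong> chain_from A h"
proof -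
  note lin = uniformD(1)[OF assms(1)]
  show ?thesis
  proof (cases "\<exists>x\<in>Field A. \<exists>y\<in>Field A. x \<noteq> y \<and> finite (interval_between A x y)")
    case False
    have rho: "rho A n = Id_on (Field A)" for n
      by (rule rho_trivial_if_dense[OF lin]) (use False in blast)
    from assms(2) obtain n where "has_rank A n" unfolding finite_rank_def ..
    then have "chain_quot A (rho A n) \<cong> chain_one" by (simp add: has_rank_def)
    then have "chain_quot A (Id_on (Field A)) \<cong> chain_one"
      by (simp only: rho)
    then obtain f where "iso (chain_quot A (Id_on (Field A))) chain_one f" unfolding chain_iso_def ..
    then have inj: "inj_on f (Field (chain_quot A (Id_on (Field A))))"
      unfolding iso_iff2 bij_betw_def by (elim conjE)
    have cls: "{u} \<in> Field (chain_quot A (Id_on (Field A)))" if "u \<in> Field A" for u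
    proof -
      have "Id_on (Field A) `` {u} = {u}" using that by auto
      moreover have "(Id_on (Field A) `` {u}, Id_on (Field A) `` {u}) \<in> chain_quot A (Id_on (Field A))"
        unfolding chain_quot_def using linear_refl[OF lin that] by blast
      ultimately have "({u}, {u}) \<in> chain_quot A (Id_on (Field A))" by simp
      then show ?thesis by (rule FieldI1)
    qed
    have "u = h" if "u \<in> Field A" for u
      using inj_onD[OF inj trans[OF unit_eq unit_eq[symmetric]] cls[OF that] cls[OF assms(3)]] by (rule singleton_inject)
    then have "Field A = {h}" using assms(3) by blast
    then show ?thesis by (rule that)
  next
    case True
    then obtain x y where 2: "x \<in> Field A" "y \<in> Field A" "x \<noteq> y" "finite (interval_between A x y)"
      by blast
    \<comment> \<open>An interval with finitely many elements begins with a point that has an immediate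
      successor; by uniformity the tail at this successor is the tail at any other point.\<close>
    have "\<exists>x y. (x, y) \<in> A \<and> x \<noteq> y \<and> finite {z. (x, z) \<in> A \<and> (z, y) \<in> A}"
    proof (cases "(x, y) \<in> A")
      case True
      moreover have "finite {z. (x, z) \<in> A \<and> (z, y) \<in> A}"
        by (rule finite_subset[OF _ 2(4)]) (auto simp: interval_between_def)
      ultimately show ?thesis using 2(3) by (intro exI[of _ x] exI[of _ y]) auto
    next
      case False
      then have "(y, x) \<in> A" using linear_total[OF lin 2(1,2)] by simp
      moreover have "finite {z. (y, z) \<in> A \<and> (z, x) \<in> A}"
        by (rule finite_subset[OF _ 2(4)]) (auto simp: interval_between_def)
      ultimately show ?thesis using 2(3) by (intro exI[of _ y] exI[of _ x]) auto
    qed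
    then obtain u v where uv: "(u, v) \<in> A" "u \<noteq> v" "finite {z. (u, z) \<in> A \<and> (z, v) \<in> A}"
      by (elim exE conjE)
    from immediate_successor[OF lin uv] obtain s where s: "s \<in> Field A" "chain_after A u = chain_from A s" .
    have "chain_after A h \<cong> chain_after A u"
      by (rule uniform_chain_after) (use assms FieldI1[OF uv(1)] in auto)
    also have "chain_after A u = chain_from A s" by fact
    also have "\<dots> \<cong> chain_from A h" by (rule uniformD(2)) fact+
    finally show ?thesis by (rule that)
  qed
qed

section \<open>Sums over natural numbers\<close>

lemma linear_natLeq:
  "Linear_order natLeq" "Linear_order (natLeq\<inverse>)"
  "linear_order_on UNIV natLeq" "linear_order_on UNIV (natLeq\<inverse>)"
  using natLeq_Linear_order by (simp_all add: Field_natLeq)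

lemma Linear_order_natLeq_Restr: "Linear_order (Restr natLeq U)" "Linear_order (Restr (natLeq\<inverse>) U)"
  by (simp_all add: Linear_order_Restr natLeq_Linear_order)

lemma natLeq_iff: "(m, n) \<in> natLeq \<longleftrightarrow> m \<le> n"
  by (simp add: natLeq_def)

lemma Field_natLeq_Restr: "Field (Restr natLeq U) = U" "Field (Restr (natLeq\<inverse>) U) = U"
  by (simp_all add: Field_Restr_linear[OF linear_natLeq(1)] Field_Restr_linear[OF linear_natLeq(2)] Field_natLeq)

lemma chain_after_natLeq_Restr:
  "chain_after (Restr natLeq {n..}) n = Restr natLeq {Suc n..}"
  "chain_after (Restr (natLeq\<inverse>) {..<Suc n}) n = Restr (natLeq\<inverse>) {..<n}"
  by (auto simp: chain_after_def aboveS_def natLeq_iff)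

lemma chain_after_natLeq:
  "chain_after natLeq n = Restr natLeq {Suc n..}"
  "chain_after (natLeq\<inverse>) n = Restr (natLeq\<inverse>) {..<n}"
  by (auto simp: chain_after_def aboveS_def natLeq_iff)

lemma one_plus_natLeq_Restr: "chain_one \<oplus> Restr natLeq {n..} \<cong> Restr natLeq {n..}"
proof -
  let ?f = "\<lambda>u. case u of Inl _ \<Rightarrow> n | Inr i \<Rightarrow> Suc i" and ?g = "\<lambda>i. if i = n then Inl () else Inr (i - 1)"
  show ?thesis
  proof (rule chain_isoI[where f = ?f and g = ?g])
    show "(?f u, ?f v) \<in> Restr natLeq {n..}" if "(u, v) \<in> chain_one \<oplus> Restr natLeq {n..}" for u v
      using that by (elim chain_plusE) (auto simp: natLeq_iff Field_natLeq_Restr)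
    show "(?g i, ?g j) \<in> chain_one \<oplus> Restr natLeq {n..}" if "(i, j) \<in> Restr natLeq {n..}" for i j
      using that by (auto simp: natLeq_iff Field_natLeq_Restr Field_chain_one chain_one_def)
  qed (auto simp: Field_chain_plus Field_natLeq_Restr Field_chain_one)
qed

section \<open>Sequences of uniform chains of finite rank\<close>

text \<open>
  Uniform chains \<open>H i\<close> of finite rank, each with a distinguished point \<open>x i\<close>.
\<close>

locale uniform_chain_sequence =
  fixes H :: "nat \<Rightarrow> 'a rel" and x :: "nat \<Rightarrow> 'a"
  assumes uniform_H: "uniform (H i)"
    and finite_rank_H: "finite_rank (H i)"
    and x_in_H: "x i \<in> Field (H i)"
begin

abbreviation P where "P \<equiv> finite_prod H"
abbreviation F where "F i \<equiv> common_tail (H i)"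
abbreviation K where "K i \<equiv> chain_below (H i) (x i)"

text \<open>
  The part of \<open>H i\<close> strictly above a point, whose order type does not depend on the point; it is
  the tail \<open>F i\<close> without its least element.
\<close>

definition R where "R i = chain_after (H i) (x i)"

text \<open>
  The right half of the infinite product, from its \<open>n\<close>-th block on. The index chain is a restriction of
  \<^const>\<open>natLeq\<close>, so that all these sums live on the same type.
\<close>

definition S where "S n = chain_sum (Restr natLeq {n..}) (\<lambda>i. P i \<otimes> F i)"

text \<open>
  The last \<open>n\<close> blocks \<open>P (n - 1) K (n - 1) + \<cdots> + P 0 K 0\<close> of the left half of the infinite product.
\<close>

definition N where "N n = chain_sum (Restr (natLeq\<inverse>) {..<n}) (\<lambda>i. P i \<otimes> K i)"

lemma linear_H: "Linear_order (H i)"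
  using uniform_H by (rule uniformD)

lemma finite_prod_Suc_iso: "P (Suc i) \<cong> P i \<otimes> H i"
  unfolding finite_prod.simps
  by (rule chain_iso_sym, rule chain_iso_inj_image) (auto simp: inj_on_def)

lemma Field_P_0: "Field (P 0) = {[]}"
  by (simp add: Field_def)

lemma uniform_P: "uniform (P i)"
proof (induction i)
  case 0
  show ?case
  proof (rule uniformI)
    show "Linear_order (P 0)" by (rule Linear_orderI) (auto simp: Field_P_0)
    show "chain_from (P 0) l \<cong> chain_from (P 0) []" if "l \<in> Field (P 0)" for l
      using that by (simp add: Field_P_0 chain_iso_refl)
  qed
next
  case (Suc i)
  show ?case
    by (rule uniform_iso[OF chain_iso_sym[OF finite_prod_Suc_iso]]) (rule uniform_times[OF Suc uniform_H])
qed

lemma linear_P: "Linear_order (P i)"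
  using uniform_P by (rule uniformD)

lemma P_nonempty: "Field (P i) \<noteq> {}"
proof (induction i)
  case (Suc i)
  then obtain l where "l \<in> Field (P i)" by blast
  then have "(x i, l) \<in> Field (P i \<otimes> H i)" by (simp add: Field_chain_times linear_P linear_H x_in_H)
  moreover obtain f where "iso (P i \<otimes> H i) (P (Suc i)) f"
    using chain_iso_sym[OF finite_prod_Suc_iso] unfolding chain_iso_def ..
  ultimately have "f (x i, l) \<in> Field (P (Suc i))" unfolding iso_iff2 by (meson bij_betwE)
  then show ?case by blast
qed (simp add: Field_P_0)

lemma linear_F: "Linear_order (F i)"
  by (simp add: common_tail_def Linear_order_parts linear_H)

lemma linear_R: "Linear_order (R i)"
  by (simp add: R_def Linear_order_parts linear_H)

lemma linear_K: "Linear_order (K i)"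
  by (simp add: Linear_order_parts linear_H)

lemma linear_S: "Linear_order (S n)"
  unfolding S_def by (intro Linear_order_sum Linear_order_natLeq_Restr Linear_order_times linear_P linear_F)

lemma linear_N: "Linear_order (N n)"
  unfolding N_def by (intro Linear_order_sum Linear_order_natLeq_Restr Linear_order_times linear_P linear_K)

lemmas linear = linear_H linear_P linear_F linear_R linear_K linear_S linear_N
  Linear_order_chain_one Linear_order_times Linear_order_plus

lemma chain_after_iso_R: "h \<in> Field (H i) \<Longrightarrow> chain_after (H i) h \<cong> R i"
  unfolding R_def by (rule uniform_chain_after[OF uniform_H _ x_in_H])

lemma F_iso: "F i \<cong> chain_from (H i) (x i)"
  by (rule chain_iso_sym, rule chain_from_iso_common_tail) (rule uniform_H x_in_H)+

lemma F_split: "F i \<cong> chain_one \<oplus> R i"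
  unfolding R_def by (rule chain_iso_trans[OF F_iso chain_from_split[OF linear_H x_in_H]])

lemma S_split: "S n \<cong> P n \<otimes> F n \<oplus> S (Suc n)"
  unfolding S_def chain_after_natLeq_Restr(1)[symmetric]
  by (rule chain_sum_first[OF Linear_order_natLeq_Restr(1)])
    (simp_all add: Field_natLeq_Restr natLeq_iff linear)

lemma N_Suc: "N (Suc n) \<cong> P n \<otimes> K n \<oplus> N n"
  unfolding N_def chain_after_natLeq_Restr(2)[of n, symmetric]
  by (rule chain_sum_first[OF Linear_order_natLeq_Restr(2)])
    (simp_all add: Field_natLeq_Restr natLeq_iff linear)

lemma F_block_split: "P n \<otimes> F n \<cong> P n \<oplus> P n \<otimes> R n"
proof -
  have "P n \<otimes> F n \<cong> P n \<otimes> (chain_one \<oplus> R n)"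
    by (intro chain_times_cong_right F_split linear)
  also have "\<dots> \<cong> P n \<otimes> chain_one \<oplus> P n \<otimes> R n"
    by (intro chain_times_plus linear)
  also have "\<dots> \<cong> P n \<oplus> P n \<otimes> R n"
    by (intro chain_plus_cong chain_times_one chain_iso_refl linear)
  finally show ?thesis .
qed

lemma H_cases:
  obtains (trivial) "H i \<cong> chain_one" "R i = {}" | (successor) "R i \<cong> F i"
proof (rule uniform_finite_rank_cases[OF uniform_H finite_rank_H x_in_H])
  assume *: "Field (H i) = {x i}"
  have "aboveS (H i) (x i) = {}"
  proof (intro equals0I)
    fix y assume "y \<in> aboveS (H i) (x i)"
    then show False using FieldI2[of "x i" y "H i"] by (simp add: aboveS_def *)
  qed
  then have "R i = {}" by (simp add: R_def chain_after_def)
  with chain_iso_oneI[OF linear_H *] show thesis by (rule trivial)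
next
  assume "chain_after (H i) (x i) \<cong> chain_from (H i) (x i)"
  also have "\<dots> \<cong> F i" by (rule chain_iso_sym[OF F_iso])
  finally show thesis by (rule successor[unfolded R_def])
qed

lemma trivial_P_Suc:
  assumes "H n \<cong> chain_one"
  shows "P (Suc n) \<cong> P n"
proof -
  have "P (Suc n) \<cong> P n \<otimes> H n" by (rule finite_prod_Suc_iso)
  also have "\<dots> \<cong> P n \<otimes> chain_one" by (intro chain_times_cong_right assms linear)
  also have "\<dots> \<cong> P n" by (intro chain_times_one linear)
  finally show ?thesis .
qed

lemma trivial_block:
  assumes "R n = {}"
  shows "P n \<otimes> F n \<cong> P n"
proof -
  have "P n \<otimes> F n \<cong> P n \<oplus> ({} :: ('a \<times> 'a list) rel)"
    using F_block_split[of n] unfolding assms chain_times_empty .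
  also have "\<dots> \<cong> P n" by (rule chain_plus_empty_right)
  finally show ?thesis .
qed

section \<open>Absorption\<close>

text \<open>
  The law \<open>P n + S n \<cong> S n\<close> in the three cases of its proof: \<open>H n\<close> has successors; \<open>H n\<close> is a point and the
  law holds for \<open>n + 1\<close>; all chains from \<open>H n\<close> on are points.
\<close>

lemma absorb_step_successor:
  assumes "R n \<cong> F n"
  shows "P n \<oplus> S n \<cong> S n"
proof -
  have "P n \<oplus> S n \<cong> P n \<oplus> (P n \<otimes> F n \<oplus> S (Suc n))"
    by (intro chain_plus_cong chain_iso_refl S_split)
  also have "\<dots> \<cong> (P n \<oplus> P n \<otimes> F n) \<oplus> S (Suc n)"
    by (rule chain_iso_sym, rule chain_plus_assoc)
  also have "\<dots> \<cong> (P n \<oplus> P n \<otimes> R n) \<oplus> S (Suc n)"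
    by (intro chain_plus_cong chain_iso_refl chain_times_cong_right linear chain_iso_sym[OF assms])
  also have "\<dots> \<cong> P n \<otimes> F n \<oplus> S (Suc n)"
    by (intro chain_plus_cong chain_iso_refl chain_iso_sym[OF F_block_split])
  also have "\<dots> \<cong> S n" by (rule chain_iso_sym[OF S_split])
  finally show ?thesis .
qed

lemma absorb_step_trivial:
  assumes "H n \<cong> chain_one" "R n = {}" "P (Suc n) \<oplus> S (Suc n) \<cong> S (Suc n)"
  shows "P n \<oplus> S n \<cong> S n"
proof -
  have "S n \<cong> P n \<otimes> F n \<oplus> S (Suc n)" by (rule S_split)
  also have "\<dots> \<cong> P (Suc n) \<oplus> S (Suc n)"
    by (intro chain_plus_cong chain_iso_refl
      chain_iso_trans[OF trivial_block[OF assms(2)] chain_iso_sym[OF trivial_P_Suc[OF assms(1)]]])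
  also have "\<dots> \<cong> S (Suc n)" by fact
  finally have *: "S n \<cong> S (Suc n)" .
  have "P n \<oplus> S n \<cong> P (Suc n) \<oplus> S (Suc n)"
    by (intro chain_plus_cong * chain_iso_sym[OF trivial_P_Suc[OF assms(1)]])
  also have "\<dots> \<cong> S (Suc n)" by fact
  also have "\<dots> \<cong> S n" by (rule chain_iso_sym[OF *])
  finally show ?thesis .
qed

lemma absorb_all_trivial:
  assumes "\<And>m. m \<ge> n \<Longrightarrow> H m \<cong> chain_one \<and> R m = {}"
  shows "P n \<oplus> S n \<cong> S n"
proof -
  have PP: "P m \<cong> P n" if "m \<ge> n" for m
    using that
  proof (induction m rule: dec_induct)
    case (step m)
    then show ?case using assms[of m] chain_iso_trans[OF trivial_P_Suc, of m "P n"] by simp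
  qed (rule chain_iso_refl)
  let ?W = "Restr natLeq {n..}"
  have "S n \<cong> P n \<otimes> ?W"
    unfolding S_def chain_times_def[of "P n"]
  proof (rule chain_sum_cong)
    fix m assume "m \<in> Field ?W"
    then have "m \<ge> n" by (simp add: Field_natLeq_Restr)
    then show "P m \<otimes> F m \<cong> P n"
      using chain_iso_trans[OF trivial_block PP] assms[of m] by simp
  qed (simp_all add: Linear_order_natLeq_Restr linear)
  then have S: "S n \<cong> P n \<otimes> ?W" .
  have "P n \<oplus> S n \<cong> P n \<otimes> chain_one \<oplus> P n \<otimes> ?W"
    by (intro chain_plus_cong S chain_iso_sym[OF chain_times_one] linear)
  also have "\<dots> \<cong> P n \<otimes> (chain_one \<oplus> ?W)"
    by (intro chain_iso_sym[OF chain_times_plus] linear Linear_order_natLeq_Restr)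
  also have "\<dots> \<cong> P n \<otimes> ?W"
    by (intro chain_times_cong_right one_plus_natLeq_Restr linear Linear_order_natLeq_Restr)
  also have "\<dots> \<cong> S n" by (rule chain_iso_sym[OF S])
  finally show ?thesis .
qed

lemma absorb: "P n \<oplus> S n \<cong> S n"
proof (cases "\<exists>m\<ge>n. R m \<cong> F m")
  case True
  then obtain m where "n \<le> m" "R m \<cong> F m" by blast
  then show ?thesis
  proof (induction n rule: inc_induct)
    case base
    then show ?case by (rule absorb_step_successor)
  next
    case (step k)
    show ?case
    proof (cases rule: H_cases[of k])
      case trivial
      then show ?thesis using step.IH[OF step.prems] by (rule absorb_step_trivial)
    next
      case successor
      then show ?thesis by (rule absorb_step_successor)
    qed
  qed
next
  case False
  show ?thesis
  proof (rule absorb_all_trivial)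
    fix m assume "n \<le> m"
    with False have "\<not> R m \<cong> F m" by blast
    then show "H m \<cong> chain_one \<and> R m = {}" using H_cases[of m] by blast
  qed
qed

lemma R_block_absorb: "P n \<otimes> R n \<oplus> S (Suc n) \<cong> S n"
proof (cases rule: H_cases[of n])
  case trivial
  have "P n \<otimes> R n \<oplus> S (Suc n) = {} \<oplus> S (Suc n)" by (simp add: trivial chain_times_empty)
  also have "{} \<oplus> S (Suc n) \<cong> S (Suc n)" by (rule chain_plus_empty)
  also have "\<dots> \<cong> P (Suc n) \<oplus> S (Suc n)" by (rule chain_iso_sym[OF absorb])
  also have "\<dots> \<cong> P n \<otimes> F n \<oplus> S (Suc n)"
    by (intro chain_plus_cong chain_iso_refl
      chain_iso_trans[OF trivial_P_Suc[OF trivial(1)] chain_iso_sym[OF trivial_block[OF trivial(2)]]])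
  also have "\<dots> \<cong> S n" by (rule chain_iso_sym[OF S_split])
  finally show ?thesis .
next
  case successor
  have "P n \<otimes> R n \<oplus> S (Suc n) \<cong> P n \<otimes> F n \<oplus> S (Suc n)"
    by (intro chain_plus_cong chain_times_cong_right chain_iso_refl successor linear)
  also have "\<dots> \<cong> S n" by (rule chain_iso_sym[OF S_split])
  finally show ?thesis .
qed

section \<open>Tails of finite products\<close>

lemma common_tail_P_Suc: "common_tail (P (Suc n)) \<cong> common_tail (P n) \<oplus> P n \<otimes> R n"
proof -
  obtain l where l: "l \<in> Field (P n)" using P_nonempty by blast
  obtain f where f: "iso (P n \<otimes> H n) (P (Suc n)) f"
    using chain_iso_sym[OF finite_prod_Suc_iso] unfolding chain_iso_def ..
  have xl: "(x n, l) \<in> Field (P n \<otimes> H n)" by (simp add: Field_chain_times linear x_in_H l)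
  then have fxl: "f (x n, l) \<in> Field (P (Suc n))"
    using f unfolding iso_iff2 bij_betw_def by blast
  have "common_tail (P (Suc n)) \<cong> chain_from (P (Suc n)) (f (x n, l))"
    by (rule chain_iso_sym[OF chain_from_iso_common_tail[OF uniform_P fxl]])
  also have "\<dots> \<cong> chain_from (P n \<otimes> H n) (x n, l)"
    by (rule chain_iso_sym[OF iso_chain_from[OF f _ xl]]) (intro linear)
  also have "\<dots> \<cong> chain_from (P n) l \<oplus> P n \<otimes> R n"
    unfolding R_def by (intro chain_times_tail linear x_in_H l)
  also have "\<dots> \<cong> common_tail (P n) \<oplus> P n \<otimes> R n"
    by (intro chain_plus_cong chain_iso_refl chain_from_iso_common_tail uniform_P l)
  finally show ?thesis .
qed

lemma common_tail_P_S: "common_tail (P n) \<oplus> S n \<cong> S 0"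
proof (induction n)
  case 0
  have "common_tail (P 0) = P 0"
    unfolding common_tail_def Field_P_0 by (auto simp: chain_from_def above_def)
  then show ?case using absorb[of 0] by simp
next
  case (Suc n)
  have "common_tail (P (Suc n)) \<oplus> S (Suc n) \<cong> (common_tail (P n) \<oplus> P n \<otimes> R n) \<oplus> S (Suc n)"
    by (intro chain_plus_cong common_tail_P_Suc chain_iso_refl)
  also have "\<dots> \<cong> common_tail (P n) \<oplus> (P n \<otimes> R n \<oplus> S (Suc n))" by (rule chain_plus_assoc)
  also have "\<dots> \<cong> common_tail (P n) \<oplus> S n"
    by (intro chain_plus_cong R_block_absorb chain_iso_refl)
  also have "\<dots> \<cong> S 0" by (rule Suc)
  finally show ?case .
qed

lemma tail_absorb: "common_tail (P n) \<oplus> (P n \<otimes> R n \<oplus> S (Suc n)) \<cong> S 0"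
proof -
  have "common_tail (P n) \<oplus> (P n \<otimes> R n \<oplus> S (Suc n)) \<cong> common_tail (P n) \<oplus> S n"
    by (intro chain_plus_cong R_block_absorb chain_iso_refl)
  also have "\<dots> \<cong> S 0" by (rule common_tail_P_S)
  finally show ?thesis .
qed

lemma block_H: "P n \<otimes> K n \<oplus> P n \<otimes> F n \<cong> P (Suc n)"
proof -
  have "P n \<otimes> K n \<oplus> P n \<otimes> F n \<cong> P n \<otimes> (K n \<oplus> F n)"
    by (intro chain_iso_sym[OF chain_times_plus] linear)
  also have "\<dots> \<cong> P n \<otimes> (K n \<oplus> chain_from (H n) (x n))"
    by (intro chain_times_cong_right chain_plus_cong chain_iso_refl F_iso linear)
  also have "\<dots> \<cong> P n \<otimes> H n"
    by (intro chain_times_cong_right chain_below_from x_in_H linear Linear_order_parts)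
  also have "\<dots> \<cong> P (Suc n)" by (rule chain_iso_sym[OF finite_prod_Suc_iso])
  finally show ?thesis .
qed

text \<open>
  Adding the blocks of the left half one by one: the new block \<open>P n K n\<close> together with the first block
  \<open>P n F n\<close> of \<open>S n\<close> forms \<open>P n H n \<cong> P (n + 1)\<close>, which the rest \<open>S (n + 1)\<close> absorbs.
\<close>

lemma N_S: "N n \<oplus> S 0 \<cong> S n"
proof (induction n)
  case 0
  have "N 0 = {}" by (simp add: N_def chain_sum_def Field_natLeq_Restr)
  then show ?case by (simp add: chain_plus_empty)
next
  case (Suc n)
  have "N (Suc n) \<oplus> S 0 \<cong> (P n \<otimes> K n \<oplus> N n) \<oplus> S 0"
    by (intro chain_plus_cong N_Suc chain_iso_refl)
  also have "\<dots> \<cong> P n \<otimes> K n \<oplus> (N n \<oplus> S 0)" by (rule chain_plus_assoc)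
  also have "\<dots> \<cong> P n \<otimes> K n \<oplus> (P n \<otimes> F n \<oplus> S (Suc n))"
    by (intro chain_plus_cong chain_iso_refl chain_iso_trans[OF Suc S_split])
  also have "\<dots> \<cong> (P n \<otimes> K n \<oplus> P n \<otimes> F n) \<oplus> S (Suc n)"
    by (rule chain_iso_sym[OF chain_plus_assoc])
  also have "\<dots> \<cong> P (Suc n) \<oplus> S (Suc n)"
    by (intro chain_plus_cong chain_iso_refl block_H)
  also have "\<dots> \<cong> S (Suc n)" by (rule absorb)
  finally show ?case .
qed

section \<open>Tails of the infinite product\<close>

lemma S_0: "S 0 = chain_sum natLeq (\<lambda>i. P i \<otimes> F i)"
proof -
  have "Restr natLeq {0..} = natLeq" by auto
  then show ?thesis by (simp only: S_def)
qed

lemma Field_S_0: "Field (S 0) = (SIGMA i:UNIV. Field (F i) \<times> Field (P i))"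
proof -
  have "Field (S 0) = (SIGMA i:Field natLeq. Field (P i \<otimes> F i))"
    unfolding S_0 by (intro Field_chain_sum linear_natLeq linear)
  then show ?thesis by (simp add: Field_natLeq Field_chain_times linear)
qed

lemma Field_left:
  "Field (chain_sum (natLeq\<inverse>) (\<lambda>i. P i \<otimes> K i)) = (SIGMA i:UNIV. Field (K i) \<times> Field (P i))"
proof -
  have "Field (chain_sum (natLeq\<inverse>) (\<lambda>i. P i \<otimes> K i)) = (SIGMA i:Field (natLeq\<inverse>). Field (P i \<otimes> K i))"
    by (intro Field_chain_sum linear_natLeq linear)
  then show ?thesis by (simp add: Field_natLeq Field_chain_times linear)
qed

lemma tail_right:
  assumes "h \<in> Field (F n)" "l \<in> Field (P n)"
  shows "chain_from (S 0) (n, h, l) \<cong> S 0"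
proof -
  let ?a = "SOME a. a \<in> Field (H n)"
  have ah: "(?a, h) \<in> H n"
    using assms(1) by (simp add: common_tail_def Field_chain_from linear)
  have "chain_from (S 0) (n, h, l) \<cong> chain_from (P n \<otimes> F n) (h, l) \<oplus> S (Suc n)"
    unfolding S_0 unfolding S_def chain_after_natLeq[symmetric]
  proof (rule chain_sum_tail[OF linear_natLeq(1)])
    show "Linear_order (P j \<otimes> F j)" for j by (intro linear)
  qed (simp_all add: Field_natLeq linear Field_chain_times assms)
  also have "\<dots> \<cong> (chain_from (P n) l \<oplus> P n \<otimes> chain_after (F n) h) \<oplus> S (Suc n)"
    by (intro chain_plus_cong chain_iso_refl chain_times_tail linear assms)
  also have "chain_after (F n) h = chain_after (H n) h"
    unfolding common_tail_def by (rule chain_after_from[OF linear_H ah])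
  also have "(chain_from (P n) l \<oplus> P n \<otimes> chain_after (H n) h) \<oplus> S (Suc n)
      \<cong> (common_tail (P n) \<oplus> P n \<otimes> R n) \<oplus> S (Suc n)"
    by (intro chain_plus_cong chain_iso_refl chain_times_cong_right chain_after_iso_R
      chain_from_iso_common_tail uniform_P linear Linear_order_parts assms FieldI2[OF ah])
  also have "\<dots> \<cong> common_tail (P n) \<oplus> (P n \<otimes> R n \<oplus> S (Suc n))" by (rule chain_plus_assoc)
  also have "\<dots> \<cong> S 0" by (rule tail_absorb)
  finally show ?thesis .
qed

text \<open>
  The tail at a point \<open>(n, k, l)\<close> of the left half is a tail of \<open>P n\<close>, then \<open>P n\<close> times the part of \<open>K n\<close>
  above \<open>k\<close>, then \<open>N n + S 0 \<cong> S n\<close>. The first block \<open>P n F n\<close> of \<open>S n\<close> completes the part above \<open>k\<close> to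
  \<open>P n R n\<close>.
\<close>

lemma tail_left:
  assumes "k \<in> Field (K n)" "l \<in> Field (P n)"
  shows "chain_from (chain_sum (natLeq\<inverse>) (\<lambda>i. P i \<otimes> K i)) (n, k, l) \<oplus> S 0 \<cong> S 0"
    (is "?L \<oplus> _ \<cong> _")
proof -
  have kx: "(k, x n) \<in> H n" "k \<noteq> x n"
    using assms(1) by (auto simp: Field_chain_below linear)
  let ?D = "chain_after (K n) k"
  have D: "?D \<oplus> F n \<cong> R n"
  proof -
    have "?D \<oplus> F n \<cong> ?D \<oplus> chain_from (H n) (x n)"
      by (intro chain_plus_cong chain_iso_refl F_iso)
    also have "\<dots> \<cong> chain_after (H n) k" by (rule chain_after_below_from[OF linear_H kx])
    also have "\<dots> \<cong> R n" by (rule chain_after_iso_R[OF FieldI1[OF kx(1)]])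
    finally show ?thesis .
  qed
  have linD: "Linear_order ?D" by (intro Linear_order_parts linear)
  have "?L \<cong> chain_from (P n \<otimes> K n) (k, l) \<oplus> N n"
    unfolding N_def chain_after_natLeq[symmetric]
  proof (rule chain_sum_tail[OF linear_natLeq(2)])
    show "Linear_order (P j \<otimes> K j)" for j by (intro linear)
  qed (simp_all add: Field_natLeq linear Field_chain_times assms)
  then have "?L \<oplus> S 0 \<cong> (chain_from (P n \<otimes> K n) (k, l) \<oplus> N n) \<oplus> S 0"
    by (intro chain_plus_cong chain_iso_refl)
  also have "\<dots> \<cong> chain_from (P n \<otimes> K n) (k, l) \<oplus> (N n \<oplus> S 0)" by (rule chain_plus_assoc)
  also have "\<dots> \<cong> (chain_from (P n) l \<oplus> P n \<otimes> ?D) \<oplus> S n"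
    by (intro chain_plus_cong N_S chain_times_tail linear assms)
  also have "\<dots> \<cong> chain_from (P n) l \<oplus> (P n \<otimes> ?D \<oplus> S n)" by (rule chain_plus_assoc)
  also have "\<dots> \<cong> common_tail (P n) \<oplus> (P n \<otimes> ?D \<oplus> (P n \<otimes> F n \<oplus> S (Suc n)))"
    by (intro chain_plus_cong chain_iso_refl S_split chain_from_iso_common_tail uniform_P assms)
  also have "\<dots> \<cong> common_tail (P n) \<oplus> ((P n \<otimes> ?D \<oplus> P n \<otimes> F n) \<oplus> S (Suc n))"
    by (intro chain_plus_cong chain_iso_refl chain_iso_sym[OF chain_plus_assoc])
  also have "\<dots> \<cong> common_tail (P n) \<oplus> (P n \<otimes> (?D \<oplus> F n) \<oplus> S (Suc n))"
    by (intro chain_plus_cong chain_iso_refl chain_iso_sym[OF chain_times_plus] linear linD)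
  also have "\<dots> \<cong> common_tail (P n) \<oplus> (P n \<otimes> R n \<oplus> S (Suc n))"
    by (intro chain_plus_cong chain_iso_refl chain_times_cong_right D linear linD)
  also have "\<dots> \<cong> S 0" by (rule tail_absorb)
  finally show ?thesis .
qed

lemma infinite_prod_eq: "infinite_prod H x = chain_sum (natLeq\<inverse>) (\<lambda>i. P i \<otimes> K i) \<oplus> S 0"
  by (simp add: infinite_prod_def S_0)

lemma linear_left: "Linear_order (chain_sum (natLeq\<inverse>) (\<lambda>i. P i \<otimes> K i))"
  by (intro Linear_order_sum linear) (simp add: linear_natLeq)

lemma tail_infinite_prod:
  assumes "p \<in> Field (infinite_prod H x)"
  shows "chain_from (infinite_prod H x) p \<cong> S 0"
proof (cases p)
  case (Inl q)
  then have q: "q \<in> Field (chain_sum (natLeq\<inverse>) (\<lambda>i. P i \<otimes> K i))"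
    using assms by (auto simp: infinite_prod_eq Field_chain_plus)
  then obtain n k l where nkl: "q = (n, k, l)" "k \<in> Field (K n)" "l \<in> Field (P n)"
    unfolding Field_left by (elim SigmaE) auto
  show ?thesis
    unfolding Inl infinite_prod_eq chain_from_plus_Inl[OF linear_left q]
    unfolding nkl(1) by (rule tail_left[OF nkl(2,3)])
next
  case (Inr q)
  then have "q \<in> Field (S 0)"
    using assms by (auto simp: infinite_prod_eq Field_chain_plus)
  then obtain n h l where nhl: "q = (n, h, l)" "h \<in> Field (F n)" "l \<in> Field (P n)"
    unfolding Field_S_0 by (elim SigmaE) auto
  have "chain_from (infinite_prod H x) p \<cong> chain_from (S 0) q"
    unfolding Inr infinite_prod_eq by (intro chain_from_plus_Inr linear linear_left)
  also have "\<dots> \<cong> S 0" unfolding nhl(1) by (rule tail_right[OF nhl(2,3)])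
  finally show ?thesis .
qed

lemma uniform_infinite_prod: "uniform (infinite_prod H x)"
proof (rule uniformI[OF _ tail_infinite_prod])
  show "Linear_order (infinite_prod H x)"
    unfolding infinite_prod_eq by (intro linear linear_left)
qed

lemma Field_infinite_prod_nonempty: "Field (infinite_prod H x) \<noteq> {}"
proof -
  have "(SOME a. a \<in> Field (H 0)) \<in> Field (F 0)"
    unfolding common_tail_def Field_chain_from[OF linear_H] mem_Collect_eq
    by (rule linear_refl[OF linear_H], rule someI, rule x_in_H)
  moreover obtain l where "l \<in> Field (P 0)" using P_nonempty by blast
  ultimately have "(0, SOME a. a \<in> Field (H 0), l) \<in> Field (S 0)"
    by (simp add: Field_S_0)
  then show ?thesis by (auto simp: infinite_prod_eq Field_chain_plus)
qed

lemma common_tail_infinite_prod: "common_tail (infinite_prod H x) \<cong> S 0"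
proof -
  obtain p where p: "p \<in> Field (infinite_prod H x)" using Field_infinite_prod_nonempty by blast
  show ?thesis
    by (rule chain_iso_trans[OF chain_iso_sym[OF chain_from_iso_common_tail[OF uniform_infinite_prod p]]
      tail_infinite_prod[OF p]])
qed

end

theorem mainTheorem4:
  fixes H :: "nat \<Rightarrow> 'a rel" and x :: "nat \<Rightarrow> 'a"
  assumes "\<And>i. uniform (H i)"
    and "\<And>i. finite_rank (H i)"
    and "\<And>i. canonical_zero (H i) (x i)"
  shows "uniform (infinite_prod H x) \<and>
         common_tail (infinite_prod H x) \<cong>
           chain_sum natLeq (\<lambda>i. chain_times (finite_prod H i) (common_tail (H i)))"
proof -
  interpret uniform_chain_sequence H x
    by unfold_locales (use assms in \<open>auto simp: canonical_zero_def\<close>)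
  show ?thesis
    using uniform_infinite_prod common_tail_infinite_prod unfolding S_0 by simp
qed

end
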